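(* Consider the system $\dot x=f(t,x)$, $t\ge t_0$, on $\mathbb{R}^n$, with $f(t,x)$ piecewise continuous in $t$, continuously differentiable in $x$, and forward complete, and let $K\subset\mathbb{R}^n$ be a compact set with nonempty interior. Let $\mu$ be the matrix measure associated with an induced norm on $\mathbb{R}^{n\times n}$. Then the topological entropy satisfies $$h(f,t_0,K)\le n\max\{\hat\mu^*,\,0\},\qquad \hat\mu^*:=\inf_{t_1\ge t_0}\ \limsup_{t\to\infty}\ \max_{v\in\operatorname{co}(\xi(t_1,t_0,K))}\mu\big(J_xf(t,\xi(t,t_1,v))\big).$$
   Context: $\xi(t,s,x)$ denotes the solution at time $t$ with state $x$ at time $s$, and $\xi(t,t_0,K):=\{\xi(t,t_0,x):x\in K\}$ is the reachable set. $J_xf(t,v)$ is the Jacobian matrix of $f(t,x)$ with respect to $x$ evaluated at $x=v$. $\operatorname{co}$ denotes convex hull. Matrix measure: for an induced norm $\|\cdot\|$ on $\mathbb{R}^{n\times n}$, $\mu(A):=\lim_{t\searrow0}\frac{\|I+tA\|-1}{t}$. Topological entropy: fix a norm $|\cdot|$ on $\mathbb{R}^n$ (the entropy does not depend on this choice). For $T\ge0$, $\varepsilon>0$, let $B_{f,t_0}(x,\varepsilon,T):=\{\bar x\in\mathbb{R}^n:\max_{t\in[t_0,t_0+T]}|\xi(t,t_0,\bar x)-\xi(t,t_0,x)|<\varepsilon\}$. A subset $E\subset K$ is $(T,\varepsilon)$-spanning if $K\subset\bigcup_{x\in E}B_{f,t_0}(x,\varepsilon,T)$; $S(f,t_0,\varepsilon,T,K)$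 is the minimal cardinality of a $(T,\varepsilon)$-spanning set. Then $h(f,t_0,K):=\lim_{\varepsilon\searrow0}\limsup_{T\to\infty}\frac1T\log S(f,t_0,\varepsilon,T,K)$ (natural logarithm).
   Formalization: The formal theorem also assumes f is locally Lipschitz in x, locally uniformly in t (as when f and its x-Jacobian are jointly continuous on each time piece up to endpoints); with only separate regularity in t and x the flow can be discontinuous and the bound fails. *)

theory Defs
  imports "HOL-Analysis.Analysis"
begin

text \<open>The index type \<open>'n\<close> plays the role of \<open>{1..n}\<close>, so that \<open>n = CARD('n)\<close>. A time-varying vector
  field is a total function \<open>f :: real \<Rightarrow> real ^ 'n \<Rightarrow> real ^ 'n\<close>, of which only the values \<open>f t x\<close> with
  \<open>t \<ge> t0\<close> are ever used.\<close>

definition is_norm :: "(real ^ 'n \<Rightarrow> real) \<Rightarrow> bool" where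
  "is_norm N \<longleftrightarrow>
     (\<forall>x. 0 \<le> N x) \<and>
     (\<forall>x. N x = 0 \<longleftrightarrow> x = 0) \<and>
     (\<forall>c x. N (c *\<^sub>R x) = \<bar>c\<bar> * N x) \<and>
     (\<forall>x y. N (x + y) \<le> N x + N y)"

definition induced_norm :: "(real ^ 'n \<Rightarrow> real) \<Rightarrow> real ^ 'n ^ 'n \<Rightarrow> real" where
  "induced_norm N A = (SUP x\<in>{x. N x = 1}. N (A *v x))"

definition matrix_measure :: "(real ^ 'n \<Rightarrow> real) \<Rightarrow> real ^ 'n ^ 'n \<Rightarrow> real" where
  "matrix_measure N A =
     Lim (at_right 0) (\<lambda>t. (induced_norm N (mat 1 + t *\<^sub>R A) - 1) / t)"

text \<open>Finitely many discontinuities in every bounded interval, with finite one-sided limits at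
  each of them; the values taken at the discontinuities are unrestricted.\<close>

definition piecewise_continuous_from :: "real \<Rightarrow> (real \<Rightarrow> 'a::t2_space) \<Rightarrow> bool" where
  "piecewise_continuous_from t0 g \<longleftrightarrow>
     (\<forall>b\<ge>t0. \<exists>D. finite D \<and> continuous_on ({t0..b} - D) g) \<and>
     (\<forall>t\<ge>t0. \<exists>l. (g \<longlongrightarrow> l) (at_right t)) \<and>
     (\<forall>t>t0. \<exists>l. (g \<longlongrightarrow> l) (at_left t))"

definition C1_map :: "(real ^ 'n \<Rightarrow> real ^ 'n) \<Rightarrow> bool" where
  "C1_map g \<longleftrightarrow>
     (\<forall>x. g differentiable (at x)) \<and> continuous_on UNIV (\<lambda>x. jacobian g (at x))"

text \<open>A (Caratheodory) solution with state \<open>x\<close> at time \<open>s\<close>. Since \<open>f\<close> may jump in \<open>t\<close>, the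
  differential equation is imposed in integrated form.\<close>

definition is_solution ::
    "(real \<Rightarrow> real ^ 'n \<Rightarrow> real ^ 'n) \<Rightarrow> real \<Rightarrow> real ^ 'n \<Rightarrow> (real \<Rightarrow> real ^ 'n) \<Rightarrow> bool" where
  "is_solution f s x \<phi> \<longleftrightarrow>
     continuous_on {s..} \<phi> \<and>
     (\<forall>t\<ge>s. ((\<lambda>\<tau>. f \<tau> (\<phi> \<tau>)) has_integral (\<phi> t - x)) {s..t})"

definition forward_complete :: "(real \<Rightarrow> real ^ 'n \<Rightarrow> real ^ 'n) \<Rightarrow> real \<Rightarrow> bool" where
  "forward_complete f t0 \<longleftrightarrow> (\<forall>s\<ge>t0. \<forall>x. \<exists>\<phi>. is_solution f s x \<phi>)"

text \<open>\<open>flow f t s x\<close> is \<open>\<xi>(t,s,x)\<close>; it is used for \<open>t0 \<le> s \<le> t\<close> only, where a local Lipschitz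
  condition on \<open>f\<close> makes the solution unique.\<close>

definition flow ::
    "(real \<Rightarrow> real ^ 'n \<Rightarrow> real ^ 'n) \<Rightarrow> real \<Rightarrow> real \<Rightarrow> real ^ 'n \<Rightarrow> real ^ 'n" where
  "flow f t s x = (THE y. \<exists>\<phi>. is_solution f s x \<phi> \<and> y = \<phi> t)"

definition reachable_set ::
    "(real \<Rightarrow> real ^ 'n \<Rightarrow> real ^ 'n) \<Rightarrow> real \<Rightarrow> real \<Rightarrow> (real ^ 'n) set \<Rightarrow> (real ^ 'n) set" where
  "reachable_set f t s K = flow f t s ` K"

definition bowen_ball ::
    "(real ^ 'n \<Rightarrow> real) \<Rightarrow> (real \<Rightarrow> real ^ 'n \<Rightarrow> real ^ 'n) \<Rightarrow> real \<Rightarrow>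
     real ^ 'n \<Rightarrow> real \<Rightarrow> real \<Rightarrow> (real ^ 'n) set" where
  "bowen_ball N f t0 x \<epsilon> T =
     {y. (SUP t\<in>{t0..t0 + T}. ereal (N (flow f t t0 y - flow f t t0 x))) < ereal \<epsilon>}"

definition is_spanning ::
    "(real ^ 'n \<Rightarrow> real) \<Rightarrow> (real \<Rightarrow> real ^ 'n \<Rightarrow> real ^ 'n) \<Rightarrow> real \<Rightarrow>
     real \<Rightarrow> real \<Rightarrow> (real ^ 'n) set \<Rightarrow> (real ^ 'n) set \<Rightarrow> bool" where
  "is_spanning N f t0 \<epsilon> T K E \<longleftrightarrow> E \<subseteq> K \<and> K \<subseteq> (\<Union>x\<in>E. bowen_ball N f t0 x \<epsilon> T)"

text \<open>The infimum of the empty set is \<open>\<infinity>\<close>, so the value is \<open>\<infinity>\<close> if there is no finite spanning set.\<close>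

definition spanning_number ::
    "(real ^ 'n \<Rightarrow> real) \<Rightarrow> (real \<Rightarrow> real ^ 'n \<Rightarrow> real ^ 'n) \<Rightarrow> real \<Rightarrow>
     real \<Rightarrow> real \<Rightarrow> (real ^ 'n) set \<Rightarrow> enat" where
  "spanning_number N f t0 \<epsilon> T K =
     (INF E\<in>{E. finite E \<and> is_spanning N f t0 \<epsilon> T K E}. enat (card E))"

definition log_enat :: "enat \<Rightarrow> ereal" where
  "log_enat k = (case k of enat m \<Rightarrow> ereal (ln (real m)) | \<infinity> \<Rightarrow> \<infinity>)"

definition topological_entropy ::
    "(real ^ 'n \<Rightarrow> real) \<Rightarrow> (real \<Rightarrow> real ^ 'n \<Rightarrow> real ^ 'n) \<Rightarrow> real \<Rightarrow> (real ^ 'n) set \<Rightarrow> ereal"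
  where
  "topological_entropy N f t0 K =
     Lim (at_right 0) (\<lambda>\<epsilon>::real.
       Limsup at_top (\<lambda>T::real. log_enat (spanning_number N f t0 \<epsilon> T K) / ereal T))"

text \<open>Extended real values, because the upper limit and the infimum can be infinite.\<close>

definition asymptotic_measure ::
    "(real ^ 'n \<Rightarrow> real) \<Rightarrow> (real \<Rightarrow> real ^ 'n \<Rightarrow> real ^ 'n) \<Rightarrow> real \<Rightarrow> (real ^ 'n) set \<Rightarrow> ereal"
  where
  "asymptotic_measure N f t0 K =
     (INF t1\<in>{t0..}. Limsup at_top (\<lambda>t::real.
        SUP v\<in>convex hull (reachable_set f t1 t0 K).
          ereal (matrix_measure N (jacobian (f t) (at (flow f t t1 v))))))"

end

theory Submission
  imports Defs
begin

text \<open>The flow separates two points of a convex set at a rate governed by the matrix measure of the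
  Jacobian along the trajectories starting in that set. To see this, fix a trajectory, let
  neighbouring trajectories converge to it and normalise their differences. These differences solve
  the variational equation up to a remainder that tends to zero pointwise in time, because \<open>f\<close> is
  differentiable in \<open>x\<close>, and boundedly, because \<open>f\<close> is locally Lipschitz; dominated convergence then
  makes the remainder negligible in Euler steps of fixed length, and on bounded sets of matrices the
  difference quotient defining \<open>\<mu>\<close> is controlled uniformly for small steps. The resulting local
  bound is chained along segments, which is where the convex hull enters. So once \<open>c\<close> exceeds
  \<open>max \<mu>* 0\<close>, distances of trajectories from \<open>K\<close> grow at most like \<open>exp (c t)\<close>, and a grid of mesh
  proportional to \<open>\<epsilon> exp (- c T)\<close> yields spanning sets of cardinality \<open>O (exp (n c T))\<close>.\<close>

section \<open>Norms and matrix measures\<close>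

text \<open>Cauchy-Schwarz in each row. The norm of a matrix here is the Euclidean norm of the
  vector of its row norms, that is the Frobenius norm and not an operator norm.\<close>

lemma norm_matrix_vector_mult_le:
  fixes A :: "real ^ 'n ^ 'm"
  shows "norm (A *v x) \<le> norm A * norm x"
proof -
  have "\<bar>(A *v x) $ i\<bar> \<le> norm (A $ i) * norm x" for i
    by (simp add: matrix_vector_mult_def inner_vec_def[symmetric] flip: inner_real_def)
       (metis Cauchy_Schwarz_ineq2 inner_vec_def inner_real_def)
  then have "norm (A *v x) \<le> L2_set (\<lambda>i. norm (A $ i) * norm x) UNIV"
    unfolding norm_vec_def by (intro L2_set_mono) auto
  also have "\<dots> = norm A * norm x"
    by (simp add: L2_set_left_distrib norm_vec_def)
  finally show ?thesis .
qed

text \<open>A locale, because several norms live on the same space: the one measuring Bowen balls,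
  the one behind the matrix measure, and the Euclidean one that mediates between them.\<close>

locale vector_norm =
  fixes M :: "real ^ 'n \<Rightarrow> real"
  assumes is_norm: "is_norm M"
begin

lemma nonneg [simp]: "0 \<le> M x"
  and eq_0_iff [simp]: "M x = 0 \<longleftrightarrow> x = 0"
  and scale: "M (c *\<^sub>R x) = \<bar>c\<bar> * M x"
  and triangle: "M (x + y) \<le> M x + M y"
  using is_norm unfolding is_norm_def by blast+

lemma zero [simp]: "M 0 = 0"
  by simp

lemma minus [simp]: "M (- x) = M x"
  using scale[of "-1" x] by simp

lemma minus_commute: "M (x - y) = M (y - x)"
  using minus[of "x - y"] by simp

lemma triangle_diff: "M x \<le> M (x - y) + M y"
  using triangle[of "x - y" y] by simp

lemma triangle3: "M (x - z) \<le> M (x - y) + M (y - z)"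
  using triangle[of "x - y" "y - z"] by simp

lemma sum_le: "M (\<Sum>i\<in>I. g i) \<le> (\<Sum>i\<in>I. M (g i))"
proof (induction I rule: infinite_finite_induct)
  case (insert i I)
  then show ?case using triangle[of "g i" "sum g I"] by simp
qed auto

lemma le_norm: obtains C where "C > 0" "\<And>x. M x \<le> C * norm x"
proof
  let ?C = "(\<Sum>i\<in>UNIV. M (axis i 1)) + 1"
  show "?C > 0" by (simp add: add_nonneg_pos sum_nonneg)
  fix x :: "real ^ 'n"
  have "M x = M (\<Sum>i\<in>UNIV. (x $ i) *\<^sub>R axis i 1)"
    by (simp add: basis_expansion flip: scalar_mult_eq_scaleR)
  also have "\<dots> \<le> (\<Sum>i\<in>UNIV. \<bar>x $ i\<bar> * M (axis i 1))"
    using sum_le[of "\<lambda>i. (x $ i) *\<^sub>R axis i 1" UNIV] by (simp add: scale)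
  also have "\<dots> \<le> (\<Sum>i\<in>UNIV. norm x * M (axis i 1))"
    by (intro sum_mono mult_right_mono component_le_norm_cart) auto
  also have "\<dots> \<le> ?C * norm x"
    by (simp add: sum_distrib_left algebra_simps)
  finally show "M x \<le> ?C * norm x" .
qed

lemma continuous_on_norm: "continuous_on S M"
proof -
  obtain C where C: "C > 0" "\<And>x. M x \<le> C * norm x" using le_norm by blast
  have "\<bar>M x - M y\<bar> \<le> C * dist x y" for x y
    using triangle_diff[of x y] triangle_diff[of y x] C(2)[of "x - y"] minus_commute[of x y]
    by (simp add: dist_norm)
  then have "C-lipschitz_on S M"
    using C(1) by (intro lipschitz_onI) (auto simp: dist_real_def)
  then show ?thesis by (rule lipschitz_on_continuous_on)
qed

text \<open>By compactness \<open>M\<close> attains its minimum on the Euclidean unit sphere; the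
  minimum is positive and its reciprocal is the constant.\<close>

lemma norm_le: obtains C where "C > 0" "\<And>x. norm x \<le> C * M x"
proof -
  have "sphere (0::real ^ 'n) 1 \<noteq> {}" by simp
  then obtain z where z: "z \<in> sphere (0::real ^ 'n) 1" "\<And>y. y \<in> sphere (0::real ^ 'n) 1 \<Longrightarrow> M z \<le> M y"
    using continuous_attains_inf[OF compact_sphere _ continuous_on_norm] by blast
  then have "z \<noteq> 0" by auto
  then have pos: "M z > 0" using nonneg[of z] eq_0_iff[of z] by linarith
  show thesis
  proof
    show "1 / M z > 0" using pos by simp
    fix x :: "real ^ 'n"
    show "norm x \<le> 1 / M z * M x"
    proof (cases "x = 0")
      case False
      then have "M z \<le> M ((1 / norm x) *\<^sub>R x)" by (intro z) simp
      also have "\<dots> = M x / norm x" by (simp add: scale)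
      finally show ?thesis using False pos by (simp add: field_simps)
    qed simp
  qed
qed

text \<open>The point reached by the step \<open>h\<close> lies on the segment from \<open>u\<close>
  to the point reached by the step \<open>k\<close>, so convexity of \<open>M\<close> carries a
  linear growth bound from a step to every shorter one.\<close>

lemma convex_step:
  assumes "0 < h" "h \<le> k" "M (u + k *\<^sub>R w) \<le> (1 + k * c) * M u"
  shows "M (u + h *\<^sub>R w) \<le> (1 + h * c) * M u"
proof -
  have "u + h *\<^sub>R w = (1 - h / k) *\<^sub>R u + (h / k) *\<^sub>R (u + k *\<^sub>R w)"
    using assms by (simp add: algebra_simps)
  then have "M (u + h *\<^sub>R w) \<le> (1 - h / k) * M u + (h / k) * M (u + k *\<^sub>R w)"
    using triangle[of "(1 - h / k) *\<^sub>R u" "(h / k) *\<^sub>R (u + k *\<^sub>R w)"] assms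
    by (simp add: scale)
  also have "\<dots> \<le> (1 - h / k) * M u + (h / k) * ((1 + k * c) * M u)"
    using assms by (intro add_left_mono mult_left_mono) auto
  also have "\<dots> = (1 + h * c) * M u" using assms by (simp add: field_simps)
  finally show ?thesis .
qed

text \<open>The triangle inequality is applied to Riemann sums over a common fine division. Gauge
  integrability of \<open>F\<close> does not make \<open>M\<close> composed with \<open>F\<close>
  integrable, so only the majorant \<open>b\<close> is integrated.\<close>

lemma integral_le:
  fixes F :: "real \<Rightarrow> real ^ 'n" and b :: "real \<Rightarrow> real"
  assumes F: "(F has_integral y) {s..t}" and b: "(b has_integral z) {s..t}"
    and le: "\<And>x. x \<in> {s..t} \<Longrightarrow> M (F x) \<le> b x"
  shows "M y \<le> z"
proof (rule field_le_epsilon)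
  fix e :: real assume e: "e > 0"
  obtain C where C: "C > 0" "\<And>x. M x \<le> C * norm x" using le_norm by blast
  obtain \<gamma>1 where g1: "gauge \<gamma>1" "\<And>\<D>. \<D> tagged_division_of {s..t} \<Longrightarrow> \<gamma>1 fine \<D> \<Longrightarrow>
      norm ((\<Sum>(x, k)\<in>\<D>. measure lborel k *\<^sub>R F x) - y) < e / (2 * C)"
    using F[unfolded has_integral_real, rule_format, of "e / (2 * C)"] e C by auto
  obtain \<gamma>2 where g2: "gauge \<gamma>2" "\<And>\<D>. \<D> tagged_division_of {s..t} \<Longrightarrow> \<gamma>2 fine \<D> \<Longrightarrow>
      norm ((\<Sum>(x, k)\<in>\<D>. measure lborel k *\<^sub>R b x) - z) < e / 2"
    using b[unfolded has_integral_real, rule_format, of "e / 2"] e by auto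
  have "gauge (\<lambda>x. \<gamma>1 x \<inter> \<gamma>2 x)" using g1 g2 by (intro gauge_Int)
  then obtain \<D> where D: "\<D> tagged_division_of {s..t}" "(\<lambda>x. \<gamma>1 x \<inter> \<gamma>2 x) fine \<D>"
    using fine_division_exists_real by blast
  let ?R = "\<Sum>(x, k)\<in>\<D>. measure lborel k *\<^sub>R F x"
  have "M ?R \<le> (\<Sum>p\<in>\<D>. M ((\<lambda>(x, k). measure lborel k *\<^sub>R F x) p))" by (rule sum_le)
  also have "\<dots> \<le> (\<Sum>(x, k)\<in>\<D>. measure lborel k *\<^sub>R b x)"
  proof (rule sum_mono)
    fix p assume p: "p \<in> \<D>"
    obtain x k where xk: "p = (x, k)" by (cases p)
    have "M (F x) \<le> b x" using D(1) p xk by (intro le) (auto dest: tag_in_interval)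
    then show "M ((\<lambda>(x, k). measure lborel k *\<^sub>R F x) p) \<le> (case p of (x, k) \<Rightarrow> measure lborel k *\<^sub>R b x)"
      by (simp add: xk scale mult_left_mono)
  qed
  also have "\<dots> \<le> z + e / 2"
    using g2(2)[OF D(1)] D(2) abs_ge_self[of "(\<Sum>(x, k)\<in>\<D>. measure lborel k *\<^sub>R b x) - z"]
    unfolding fine_Int real_norm_def by linarith
  finally have R: "M ?R \<le> z + e / 2" .
  have "M (?R - y) \<le> C * norm (?R - y)" by (rule C)
  also have "\<dots> \<le> C * (e / (2 * C))"
    using g1(2)[OF D(1)] D(2) C(1) by (intro mult_left_mono) (auto simp: fine_Int)
  also have "\<dots> = e / 2" using C by simp
  finally show "M y \<le> z + e" using R triangle_diff[of y ?R] minus_commute[of y ?R] by simp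
qed

section \<open>Induced norms and the difference quotient of the matrix measure\<close>

lemma induced_norm_bdd_above: "bdd_above ((\<lambda>x. M (A *v x)) ` {x. M x = 1})"
proof -
  obtain C where C: "C > 0" "\<And>x. M x \<le> C * norm x" using le_norm by blast
  obtain D where D: "D > 0" "\<And>x. norm x \<le> D * M x" using norm_le by blast
  have "M (A *v x) \<le> C * (norm A * D)" if "M x = 1" for x
  proof -
    have "norm (A *v x) \<le> norm A * D"
      using norm_matrix_vector_mult_le[of A x] D(2)[of x] that
        mult_left_mono[of "norm x" D "norm A"] by simp
    then show ?thesis using C(2)[of "A *v x"] C(1) mult_left_mono order_trans
      by (smt (verit, best))
  qed
  then show ?thesis by (intro bdd_aboveI[of _ "C * (norm A * D)"]) auto
qed

lemma le_induced_norm: "M (A *v x) \<le> induced_norm M A * M x"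
proof (cases "x = 0")
  case False
  then have pos: "M x > 0" using nonneg[of x] eq_0_iff[of x] by linarith
  have "M ((1 / M x) *\<^sub>R x) = 1" using pos by (simp add: scale False)
  then have "M (A *v ((1 / M x) *\<^sub>R x)) \<le> induced_norm M A"
    unfolding induced_norm_def by (intro cSUP_upper induced_norm_bdd_above) simp
  then show ?thesis using pos by (simp add: matrix_vector_mult_scaleR scale field_simps)
qed simp

lemma ex_unit: "\<exists>x. M x = 1"
proof -
  obtain x :: "real ^ 'n" where "x \<noteq> 0" using UNIV_not_singleton[of "0 :: real ^ 'n"] by auto
  then have "M ((1 / M x) *\<^sub>R x) = 1" by (simp add: scale)
  then show ?thesis ..
qed

lemma induced_norm_le:
  assumes "\<And>x. M x = 1 \<Longrightarrow> M (A *v x) \<le> c"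
  shows "induced_norm M A \<le> c"
  unfolding induced_norm_def using assms ex_unit by (intro cSUP_least) auto

lemma step_le_induced_norm:
  "M (u + h *\<^sub>R (A *v u)) \<le> induced_norm M (mat 1 + h *\<^sub>R A) * M u"
  using le_induced_norm[of "mat 1 + h *\<^sub>R A" u]
  by (simp add: matrix_vector_mult_add_rdistrib scaleR_matrix_vector_assoc)

text \<open>By convexity of \<open>M\<close> the difference quotient in the matrix measure is monotone, so the limit
  exists.\<close>

lemma matrix_measure_tendsto:
  "((\<lambda>t. (induced_norm M (mat 1 + t *\<^sub>R A) - 1) / t) \<longlongrightarrow> matrix_measure M A) (at_right 0)"
proof -
  define q where "q t = (induced_norm M (mat 1 + t *\<^sub>R A) - 1) / t" for t :: real
  have mono: "q h \<le> q k" if "0 < h" "h \<le> k" for h k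
  proof -
    have "M (u + h *\<^sub>R (A *v u)) \<le> (1 + h * q k) * M u" for u
      using that step_le_induced_norm[of u k A] by (intro convex_step[of h k]) (auto simp: q_def)
    then have "induced_norm M (mat 1 + h *\<^sub>R A) \<le> 1 + h * q k"
      by (intro induced_norm_le)
        (metis matrix_vector_mult_add_rdistrib matrix_vector_mul_lid mult.right_neutral
          scaleR_matrix_vector_assoc)
    then show ?thesis using that by (simp add: q_def[of h] divide_simps mult.commute)
  qed
  \<comment> \<open>The triangle inequality at a unit vector bounds the quotient from below.
    Together with monotonicity this makes its infimum over positive steps the right limit at
    0.\<close>
  have lower: "- induced_norm M A \<le> q h" if "0 < h" for h
  proof -
    obtain x where x: "M x = 1" using ex_unit by blast
    have "1 \<le> M (x + h *\<^sub>R (A *v x)) + h * M (A *v x)"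
      using triangle_diff[of x "- h *\<^sub>R (A *v x)"] x that by (simp add: scale)
    also have "\<dots> \<le> induced_norm M (mat 1 + h *\<^sub>R A) + h * induced_norm M A"
      using step_le_induced_norm[of x h A] le_induced_norm[of A x] that x
      by (intro add_mono mult_left_mono) auto
    finally show ?thesis using that by (simp add: q_def divide_simps mult.commute)
  qed
  have bdd: "bdd_below (q ` {0<..})" using lower by (intro bdd_belowI[of _ "- induced_norm M A"]) auto
  have "(q \<longlongrightarrow> Inf (q ` {0<..})) (at_right 0)"
  proof (rule order_tendstoI)
    fix a assume "a < Inf (q ` {0<..})"
    then have "a < q h" if "h > 0" for h
      using cINF_lower[OF bdd, of h] that by simp
    then show "\<forall>\<^sub>F h in at_right 0. a < q h" by (auto simp: eventually_at_right_field intro: exI[of _ 1])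
  next
    fix a assume "Inf (q ` {0<..}) < a"
    then obtain k where "k > 0" "q k < a" using cInf_lessD[of "q ` {0<..}" a] by auto
    then have "\<forall>h>0. h < k \<longrightarrow> q h < a" using mono less_imp_le order_le_less_trans by blast
    then show "\<forall>\<^sub>F h in at_right 0. q h < a"
      using \<open>k > 0\<close> by (auto simp: eventually_at_right_field)
  qed
  then show ?thesis
    unfolding matrix_measure_def q_def[abs_def, symmetric] by (metis tendsto_Lim trivial_limit_at_right_real)
qed

text \<open>The limit defining the matrix measure yields an admissible step \<open>H A\<close> for
  each single matrix. Finitely many balls of radius \<open>r\<close> around matrices of
  \<open>S\<close> cover the bounded set \<open>S\<close>; the smallest step of their centres works
  for all of \<open>S\<close>, since passing from a centre to a nearby matrix costs at most
  \<open>c' - d\<close> per unit of step.\<close>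

lemma uniform_step:
  assumes "c < c'"
  obtains h0 where "h0 > 0"
    "\<And>A h u. norm A \<le> L \<Longrightarrow> matrix_measure M A \<le> c \<Longrightarrow> 0 < h \<Longrightarrow> h \<le> h0 \<Longrightarrow>
      M (u + h *\<^sub>R (A *v u)) \<le> (1 + h * c') * M u"
proof -
  obtain C where C: "C > 0" "\<And>x. M x \<le> C * norm x" using le_norm by blast
  obtain D where D: "D > 0" "\<And>x. norm x \<le> D * M x" using norm_le by blast
  \<comment> \<open>Half of the gap is spent on the limit at the centres, the other half on the
    perturbation.\<close>
  define d where "d = (c + c') / 2"
  have d: "c < d" "d < c'" using assms by (auto simp: d_def)
  \<comment> \<open>With this radius the perturbation estimate \<open>C * (r * (D * M u))\<close>
    equals \<open>(c' - d) * M u\<close>.\<close>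
  define r where "r = (c' - d) / (C * D)"
  have r: "r > 0" using C D d by (simp add: r_def)
  define S where "S = {A. norm A \<le> L \<and> matrix_measure M A \<le> c}"
  have "\<exists>h>0. induced_norm M (mat 1 + h *\<^sub>R A) \<le> 1 + h * d" if "A \<in> S" for A
  proof -
    have "matrix_measure M A < d" using that d by (simp add: S_def)
    then have "\<forall>\<^sub>F h in at_right 0. (induced_norm M (mat 1 + h *\<^sub>R A) - 1) / h < d"
      using matrix_measure_tendsto order_tendstoD(2) by blast
    moreover have "\<forall>\<^sub>F h in at_right (0::real). h > 0" by (simp add: eventually_at_right_less)
    ultimately have "\<forall>\<^sub>F h in at_right 0. h > 0 \<and> (induced_norm M (mat 1 + h *\<^sub>R A) - 1) / h < d"
      by eventually_elim simp
    then obtain h where "h > 0" "(induced_norm M (mat 1 + h *\<^sub>R A) - 1) / h < d"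
      using eventually_happens trivial_limit_at_right_real by blast
    then show ?thesis by (intro exI[of _ h]) (simp add: field_simps)
  qed
  then obtain H where H: "\<And>A. A \<in> S \<Longrightarrow> H A > 0"
    "\<And>A. A \<in> S \<Longrightarrow> induced_norm M (mat 1 + H A *\<^sub>R A) \<le> 1 + H A * d" by metis
  have "bounded S" by (rule boundedI[of _ L]) (simp add: S_def)
  then have "compact (closure S)" by (simp add: compact_closure)
  moreover have "closure S \<subseteq> (\<Union>A\<in>S. ball A r)"
  proof
    fix B assume "B \<in> closure S"
    then obtain A where "A \<in> S" "dist A B < r" using r closure_approachable by blast
    then show "B \<in> (\<Union>A\<in>S. ball A r)" by auto
  qed
  ultimately obtain F where F: "F \<subseteq> S" "finite F" "closure S \<subseteq> (\<Union>A\<in>F. ball A r)"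
    using compactE_image[of "closure S" S "\<lambda>A. ball A r"] by auto
  define h0 where "h0 = Min (insert 1 (H ` F))"
  show thesis
  proof
    show "h0 > 0" using F H by (auto simp: h0_def)
    fix A :: "real ^ 'n ^ 'n" and h u
    assume A: "norm A \<le> L" "matrix_measure M A \<le> c" and h: "0 < h" "h \<le> h0"
    then have "A \<in> closure S" using closure_subset[of S] unfolding S_def by blast
    then obtain B where B: "B \<in> F" "dist B A < r" using F by auto
    then have BS: "B \<in> S" using F by auto
    have "h \<le> H B" using h B(1) F(2) by (simp add: h0_def)
    have "M (u + H B *\<^sub>R (B *v u)) \<le> induced_norm M (mat 1 + H B *\<^sub>R B) * M u"
      by (rule step_le_induced_norm)
    also have "\<dots> \<le> (1 + H B * d) * M u" using H(2)[OF BS] by (intro mult_right_mono) auto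
    finally have "M (u + h *\<^sub>R (B *v u)) \<le> (1 + h * d) * M u"
      using convex_step h \<open>h \<le> H B\<close> by blast
    moreover have "M ((A - B) *v u) \<le> (c' - d) * M u"
    proof -
      have "M ((A - B) *v u) \<le> C * norm ((A - B) *v u)" by (rule C)
      also have "\<dots> \<le> C * (norm (A - B) * norm u)"
        using C norm_matrix_vector_mult_le by (intro mult_left_mono) auto
      also have "\<dots> \<le> C * (r * (D * M u))"
        using C D B r by (intro mult_left_mono mult_mono) (auto simp: dist_norm norm_minus_commute)
      also have "\<dots> = (c' - d) * M u" using C D by (simp add: r_def)
      finally show ?thesis .
    qed
    moreover have "u + h *\<^sub>R (A *v u) = (u + h *\<^sub>R (B *v u)) + h *\<^sub>R ((A - B) *v u)"
      by (simp add: matrix_vector_mult_diff_rdistrib algebra_simps)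
    ultimately have "M (u + h *\<^sub>R (A *v u)) \<le> (1 + h * d) * M u + h * ((c' - d) * M u)"
      using triangle[of "u + h *\<^sub>R (B *v u)" "h *\<^sub>R ((A - B) *v u)"] h
        mult_left_mono[OF \<open>M ((A - B) *v u) \<le> (c' - d) * M u\<close> less_imp_le[OF h(1)]]
      by (simp only: scale abs_of_pos)
    then show "M (u + h *\<^sub>R (A *v u)) \<le> (1 + h * c') * M u" by (simp add: algebra_simps)
  qed
qed

end

section \<open>Dependence of the flow on the initial state\<close>

text \<open>While \<open>e\<close> is only continuous, its integral majorant \<open>E\<close> is
  differentiable, and \<open>e\<close> being below \<open>E\<close> says that \<open>E\<close> times
  the integrating factor does not increase.\<close>

lemma gronwall:
  fixes e :: "real \<Rightarrow> real"
  assumes cont: "continuous_on {s..t} e" and L: "0 \<le> L"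
    and le: "\<And>\<tau>. \<tau> \<in> {s..t} \<Longrightarrow> e \<tau> \<le> a + L * integral {s..\<tau>} e"
    and \<tau>: "\<tau> \<in> {s..t}"
  shows "e \<tau> \<le> a * exp (L * (\<tau> - s))"
proof -
  define E where "E \<tau> = a + L * integral {s..\<tau>} e" for \<tau>
  define F where "F \<tau> = E \<tau> * exp (- L * (\<tau> - s))" for \<tau>
  have "((\<lambda>u. integral {s..u} e) has_real_derivative e x) (at x within {s..t})" if "x \<in> {s..t}" for x
    using integral_has_real_derivative[OF cont that] .
  then have der: "(F has_real_derivative (L * (e x - E x)) * exp (- L * (x - s))) (at x within {s..t})"
    if "x \<in> {s..t}" for x
    using that unfolding F_def E_def
    by (auto intro!: derivative_eq_intros simp: algebra_simps)
  have "F \<tau> \<le> F s"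
  proof (rule DERIV_nonpos_imp_decreasing_open[of s \<tau> F])
    show "s \<le> \<tau>" using \<tau> by simp
    show "continuous_on {s..\<tau>} F"
      using DERIV_continuous_on[OF der] \<tau> by (auto intro: continuous_on_subset)
    show "\<exists>y. (F has_real_derivative y) (at x) \<and> y \<le> 0" if "s < x" "x < \<tau>" for x
    proof (intro exI conjI)
      have "at x within {s..t} = at x" using that \<tau> by (intro at_within_interior) auto
      then show "(F has_real_derivative (L * (e x - E x)) * exp (- L * (x - s))) (at x)"
        using der[of x] that \<tau> by auto
      have "e x \<le> E x" unfolding E_def using that \<tau> by (intro le) auto
      then show "(L * (e x - E x)) * exp (- L * (x - s)) \<le> 0"
        using L by (intro mult_nonpos_nonneg mult_nonneg_nonpos) auto
    qed
  qed
  then have "E \<tau> * exp (- L * (\<tau> - s)) \<le> a" by (simp add: F_def E_def)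
  then have "E \<tau> * exp (- L * (\<tau> - s)) * exp (L * (\<tau> - s)) \<le> a * exp (L * (\<tau> - s))"
    by (intro mult_right_mono) auto
  moreover have "exp (- L * (\<tau> - s)) * exp (L * (\<tau> - s)) = 1" by (simp flip: exp_add)
  ultimately have "E \<tau> \<le> a * exp (L * (\<tau> - s))" by (simp only: mult.assoc mult_1_right)
  then show ?thesis using le[OF \<tau>] by (simp add: E_def)
qed

text \<open>Stands in for the mean value theorem, so that the flow need not be differentiated in the
  initial state.\<close>

lemma (in vector_norm) segment_bound:
  fixes g :: "real ^ 'n \<Rightarrow> real ^ 'n"
  assumes "convex C" "x \<in> C" "y \<in> C"
    and local: "\<And>v. v \<in> C \<Longrightarrow> \<exists>d>0. \<forall>w\<in>C. norm (w - v) < d \<longrightarrow> M (g w - g v) \<le> B * M (w - v)"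
  shows "M (g y - g x) \<le> B * M (y - x)"
proof (cases "x = y")
  case False
  define p where "p r = x + r *\<^sub>R (y - x)" for r
  have pC: "p r \<in> C" if "0 \<le> r" "r \<le> 1" for r
  proof -
    have "p r = (1 - r) *\<^sub>R x + r *\<^sub>R y" by (simp add: p_def algebra_simps)
    then show ?thesis using assms that by (simp add: convexD_alt)
  qed
  have pdiff: "p r - p q = (r - q) *\<^sub>R (y - x)" for r q by (simp add: p_def algebra_simps)
  \<comment> \<open>Bolzano's bisection principle: the estimate is additive over adjacent intervals,
    and near each \<open>z\<close> it holds for intervals containing \<open>z\<close>, which are
    split at \<open>z\<close> because the local hypothesis compares with \<open>p z\<close> only.
    The guards in the predicate handle small intervals that leave the unit interval.\<close>
  have "0 \<le> (0::real) \<longrightarrow> 1 \<le> (1::real) \<longrightarrow> M (g (p 1) - g (p 0)) \<le> B * M (y - x) * (1 - 0)"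
  proof (rule Bolzano[where P = "\<lambda>q r. 0 \<le> q \<longrightarrow> r \<le> 1 \<longrightarrow> M (g (p r) - g (p q)) \<le> B * M (y - x) * (r - q)"])
    show "0 \<le> a \<longrightarrow> c \<le> 1 \<longrightarrow> M (g (p c) - g (p a)) \<le> B * M (y - x) * (c - a)"
      if "0 \<le> a \<longrightarrow> b \<le> 1 \<longrightarrow> M (g (p b) - g (p a)) \<le> B * M (y - x) * (b - a)"
        "0 \<le> b \<longrightarrow> c \<le> 1 \<longrightarrow> M (g (p c) - g (p b)) \<le> B * M (y - x) * (c - b)" "a \<le> b" "b \<le> c"
      for a b c
      using that triangle3[of "g (p c)" "g (p a)" "g (p b)"]
      by (auto simp: algebra_simps)
  next
    fix z :: real assume z: "0 \<le> z" "z \<le> 1"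
    obtain d where d: "d > 0" "\<And>w. w \<in> C \<Longrightarrow> norm (w - p z) < d \<Longrightarrow> M (g w - g (p z)) \<le> B * M (w - p z)"
      using local[OF pC[OF z]] by blast
    have near: "M (g (p r) - g (p z)) \<le> B * M (y - x) * \<bar>r - z\<bar>"
      if "0 \<le> r" "r \<le> 1" "\<bar>r - z\<bar> < d / norm (y - x)" for r
    proof -
      have "norm (p r - p z) < d" using that False by (simp add: pdiff pos_less_divide_eq)
      then have "M (g (p r) - g (p z)) \<le> B * M (p r - p z)" using d(2) pC that by blast
      then show ?thesis by (simp add: pdiff scale mult.commute mult.left_commute)
    qed
    show "\<exists>d>0. \<forall>a b. a \<le> z \<and> z \<le> b \<and> b - a < d \<longrightarrow>
        0 \<le> a \<longrightarrow> b \<le> 1 \<longrightarrow> M (g (p b) - g (p a)) \<le> B * M (y - x) * (b - a)"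
    proof (intro exI conjI allI impI)
      show "0 < d / norm (y - x)" using d False by simp
      fix a b assume ab: "a \<le> z \<and> z \<le> b \<and> b - a < d / norm (y - x)" "0 \<le> a" "b \<le> 1"
      have "M (g (p b) - g (p z)) \<le> B * M (y - x) * (b - z)" using near[of b] ab z by simp
      moreover have "M (g (p a) - g (p z)) \<le> B * M (y - x) * (z - a)" using near[of a] ab z by simp
      ultimately show "M (g (p b) - g (p a)) \<le> B * M (y - x) * (b - a)"
        using triangle3[of "g (p b)" "g (p a)" "g (p z)"] minus_commute[of "g (p z)" "g (p a)"]
        by (simp add: algebra_simps)
    qed
  qed simp
  then show ?thesis by (simp add: p_def)
qed simp

section \<open>Caratheodory solutions, uniqueness and the flow\<close>

lemma is_norm_norm: "is_norm (norm :: real ^ 'n \<Rightarrow> real)"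
  by (auto simp: is_norm_def norm_triangle_ineq)

interpretation euclid: vector_norm "norm :: real ^ 'n \<Rightarrow> real"
  by unfold_locales (rule is_norm_norm)

lemma is_solutionD:
  assumes "is_solution f s x \<phi>"
  shows "continuous_on {s..b} \<phi>" "\<phi> s = x"
proof -
  show "continuous_on {s..b} \<phi>"
    using assms by (auto simp: is_solution_def intro: continuous_on_subset)
  \<comment> \<open>The initial condition is not a separate clause of \<open>is_solution\<close>; it
    is the integral equation over a degenerate interval.\<close>
  have "((\<lambda>\<tau>. f \<tau> (\<phi> \<tau>)) has_integral (\<phi> s - x)) {s..s}"
    using assms unfolding is_solution_def by blast
  then have "\<phi> s - x = 0"     by (metis atLeastAtMost_singleton has_integral_refl(2) has_integral_unique)
  then show "\<phi> s = x" by simp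
qed

lemma is_solution_has_integral:
  assumes "is_solution f s x \<phi>" "s \<le> a" "a \<le> b"
  shows "((\<lambda>\<tau>. f \<tau> (\<phi> \<tau>)) has_integral (\<phi> b - \<phi> a)) {a..b}"
proof -
  have I: "((\<lambda>\<tau>. f \<tau> (\<phi> \<tau>)) has_integral (\<phi> t - x)) {s..t}" if "s \<le> t" for t
    using assms that by (simp add: is_solution_def)
  have "(\<lambda>\<tau>. f \<tau> (\<phi> \<tau>)) integrable_on {s..b}" using I[of b] assms by auto
  then have int: "(\<lambda>\<tau>. f \<tau> (\<phi> \<tau>)) integrable_on {a..b}"
    using assms by (elim integrable_subinterval_real) auto
  have "((\<lambda>\<tau>. f \<tau> (\<phi> \<tau>)) has_integral ((\<phi> a - x) + integral {a..b} (\<lambda>\<tau>. f \<tau> (\<phi> \<tau>)))) {s..b}"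
    using assms I[of a] int by (intro has_integral_combine[of s a b]) (auto intro: integrable_integral)
  then have "(\<phi> a - x) + integral {a..b} (\<lambda>\<tau>. f \<tau> (\<phi> \<tau>)) = \<phi> b - x"
    using I[of b] assms has_integral_unique by (meson order_trans)
  then have "integral {a..b} (\<lambda>\<tau>. f \<tau> (\<phi> \<tau>)) = \<phi> b - \<phi> a" by (simp add: algebra_simps)
  then show ?thesis using int has_integral_integral by metis
qed

lemma is_solution_shift:
  assumes "is_solution f s x \<phi>" "s \<le> a"
  shows "is_solution f a (\<phi> a) \<phi>"
  using assms is_solution_has_integral[OF assms]
  by (auto simp: is_solution_def intro: continuous_on_subset)

text \<open>The Lipschitz estimate is asked for along the two trajectories only. So the lemma serves
  both to show that a solution stays in a tube and to compare two solutions inside it.\<close>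

lemma solution_gronwall:
  assumes \<phi>: "is_solution f a x \<phi>" and \<psi>: "is_solution f a y \<psi>" and "a \<le> t" and L: "0 \<le> L"
    and lip: "\<And>\<sigma>. \<sigma> \<in> {a..t} \<Longrightarrow> norm (f \<sigma> (\<psi> \<sigma>) - f \<sigma> (\<phi> \<sigma>)) \<le> L * norm (\<psi> \<sigma> - \<phi> \<sigma>)"
  shows "norm (\<psi> t - \<phi> t) \<le> exp (L * (t - a)) * norm (y - x)"
proof -
  define e where "e t = norm (\<psi> t - \<phi> t)" for t
  have econt: "continuous_on {a..t} e"
    unfolding e_def using is_solutionD(1)[OF \<psi>] is_solutionD(1)[OF \<phi>] by (intro continuous_intros)
  have "e t \<le> norm (y - x) * exp (L * (t - a))"
  proof (rule gronwall[OF econt L])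
    fix \<sigma> assume \<sigma>: "\<sigma> \<in> {a..t}"
    have "((\<lambda>q. f q (\<psi> q) - f q (\<phi> q)) has_integral (\<psi> \<sigma> - \<psi> a) - (\<phi> \<sigma> - \<phi> a)) {a..\<sigma>}"
      using \<sigma> by (intro has_integral_diff is_solution_has_integral[OF \<phi>] is_solution_has_integral[OF \<psi>]) auto
    moreover have "((\<lambda>q. L * e q) has_integral L * integral {a..\<sigma>} e) {a..\<sigma>}"
      using continuous_on_subset[OF econt, of "{a..\<sigma>}"] \<sigma>
      by (intro has_integral_mult_right integrable_integral integrable_continuous_real) auto
    moreover have "norm (f q (\<psi> q) - f q (\<phi> q)) \<le> L * e q" if "q \<in> {a..\<sigma>}" for q
      using lip[of q] that \<sigma> by (simp add: e_def)
    ultimately have "norm ((\<psi> \<sigma> - \<psi> a) - (\<phi> \<sigma> - \<phi> a)) \<le> L * integral {a..\<sigma>} e"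
      using euclid.integral_le by blast
    then show "e \<sigma> \<le> norm (y - x) + L * integral {a..\<sigma>} e"
      using norm_triangle_ineq[of "(\<psi> \<sigma> - \<psi> a) - (\<phi> \<sigma> - \<phi> a)" "y - x"]
        is_solutionD(2)[OF \<phi>] is_solutionD(2)[OF \<psi>]
      by (simp add: e_def algebra_simps)
  qed (use \<open>a \<le> t\<close> in auto)
  then show ?thesis by (simp add: e_def mult.commute)
qed

locale complete_system =
  fixes f :: "real \<Rightarrow> real ^ 'n \<Rightarrow> real ^ 'n" and t0 :: real
  assumes lipschitz: "local_lipschitz {t0..} UNIV f"
    and complete: "forward_complete f t0"
begin

text \<open>Bisection again: constants for adjacent intervals merge by taking the smaller radius and
  the larger Lipschitz constant. Near a time \<open>z\<close>, continuity keeps the ball of radius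
  \<open>u / 2\<close> around the moving centre inside the fixed ball of radius
  \<open>u\<close>.\<close>

lemma tube:
  fixes \<phi> :: "real \<Rightarrow> real ^ 'n"
  assumes "t0 \<le> a" "a \<le> b" and cont: "continuous_on {a..b} \<phi>"
  obtains r L where "r > 0" "0 \<le> L" "\<And>t. t \<in> {a..b} \<Longrightarrow> L-lipschitz_on (cball (\<phi> t) r) (f t)"
proof -
  let ?P = "\<lambda>p q. \<exists>r>0. \<exists>L\<ge>0. \<forall>t\<in>{p..q} \<inter> {a..b}. L-lipschitz_on (cball (\<phi> t) r) (f t)"
  have "?P a b"
  proof (rule Bolzano[where P = ?P])
    show "a \<le> b" by fact
  next
    fix p q s :: real assume "?P p q" "?P q s" "p \<le> q" "q \<le> s"
    then obtain r1 L1 r2 L2 where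
      1: "r1 > 0" "L1 \<ge> 0" "\<And>t. t \<in> {p..q} \<inter> {a..b} \<Longrightarrow> L1-lipschitz_on (cball (\<phi> t) r1) (f t)" and
      2: "r2 > 0" "L2 \<ge> 0" "\<And>t. t \<in> {q..s} \<inter> {a..b} \<Longrightarrow> L2-lipschitz_on (cball (\<phi> t) r2) (f t)"
      by metis
    show "?P p s"
    proof (intro exI conjI ballI)
      show "min r1 r2 > 0" "max L1 L2 \<ge> 0" using 1 2 by auto
      fix t assume t: "t \<in> {p..s} \<inter> {a..b}"
      show "(max L1 L2)-lipschitz_on (cball (\<phi> t) (min r1 r2)) (f t)"
      proof (cases "t \<le> q")
        case True
        then show ?thesis using t 1 by (intro lipschitz_on_mono[OF 1(3)]) auto
      next
        case False
        then show ?thesis using t 2 by (intro lipschitz_on_mono[OF 2(3)]) auto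
      qed
    qed
  next
    fix z assume z: "a \<le> z" "z \<le> b"
    then obtain u L where u: "u > 0"
      and L: "\<And>s. s \<in> cball z u \<inter> {t0..} \<Longrightarrow> L-lipschitz_on (cball (\<phi> z) u \<inter> UNIV) (f s)"
      using local_lipschitzE[OF lipschitz, of z "\<phi> z"] assms by auto
    obtain d where d: "d > 0" "\<And>t. t \<in> {a..b} \<Longrightarrow> dist t z < d \<Longrightarrow> dist (\<phi> t) (\<phi> z) < u / 2"
      using cont[unfolded continuous_on_iff, rule_format, of z "u / 2"] z u by auto
    show "\<exists>d>0. \<forall>p q. p \<le> z \<and> z \<le> q \<and> q - p < d \<longrightarrow> ?P p q"
    proof (intro exI conjI allI impI ballI)
      show "min d u > 0" using d u by simp
      fix p q assume pq: "p \<le> z \<and> z \<le> q \<and> q - p < min d u"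
      show "u / 2 > 0" using u by simp
      show "L \<ge> 0" using L[of z] z assms u lipschitz_on_nonneg by auto
      fix t assume t: "t \<in> {p..q} \<inter> {a..b}"
      then have tz: "dist t z < min d u" using pq by (auto simp: dist_real_def)
      have "cball (\<phi> t) (u / 2) \<subseteq> cball (\<phi> z) u"
      proof
        fix y assume "y \<in> cball (\<phi> t) (u / 2)"
        then show "y \<in> cball (\<phi> z) u"
          using d(2)[of t] t tz dist_triangle[of "\<phi> z" y "\<phi> t"] by (auto simp: dist_commute)
      qed
      then show "L-lipschitz_on (cball (\<phi> t) (u / 2)) (f t)"
        using t tz assms by (intro lipschitz_on_subset[OF L]) (auto simp: dist_commute)
    qed
  qed
  then show thesis using that by auto
qed

text \<open>Solutions starting within \<open>d\<close> of \<open>x\<close> cannot leave the tube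
  around \<phi> before \<open>b\<close>, since Gronwall amplifies the initial distance by at most
  the factor by which \<open>d\<close> is smaller than \<open>r\<close>. Inside the tube Gronwall
  then compares any two of them. The last conclusion exports the constant of the tube, which later
  bounds the Jacobians along the trajectory.\<close>

lemma local_dependence:
  assumes \<phi>: "is_solution f a x \<phi>" and ab: "t0 \<le> a" "a \<le> b"
  obtains d L where "d > 0" "L \<ge> 0"
    "\<And>y z \<psi> \<theta> t. norm (y - x) < d \<Longrightarrow> norm (z - x) < d \<Longrightarrow>
      is_solution f a y \<psi> \<Longrightarrow> is_solution f a z \<theta> \<Longrightarrow> t \<in> {a..b} \<Longrightarrow>
      norm (\<psi> t - \<theta> t) \<le> exp (L * (b - a)) * norm (y - z) \<and>
      norm (f t (\<psi> t) - f t (\<theta> t)) \<le> L * norm (\<psi> t - \<theta> t)"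
    "\<And>t. t \<in> {a..b} \<Longrightarrow> \<exists>r>0. L-lipschitz_on (cball (\<phi> t) r) (f t)"
proof -
  obtain r L where r: "r > 0" and L: "0 \<le> L" and
    lip: "\<And>t. t \<in> {a..b} \<Longrightarrow> L-lipschitz_on (cball (\<phi> t) r) (f t)"
    using tube[OF ab is_solutionD(1)[OF \<phi>]] by metis
  define d where "d = r / exp (L * (b - a))"
  have lip': "norm (f t u - f t v) \<le> L * norm (u - v)"
    if "t \<in> {a..b}" "norm (u - \<phi> t) \<le> r" "norm (v - \<phi> t) \<le> r" for t u v
    using lipschitz_onD[OF lip, of t u v] that by (simp add: dist_norm norm_minus_commute)
  have stay: "norm (\<psi> t - \<phi> t) < r"
    if y: "norm (y - x) < d" and \<psi>: "is_solution f a y \<psi>" and t: "t \<in> {a..b}" for y \<psi> t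
  proof -
    define e where "e t = norm (\<psi> t - \<phi> t)" for t
    have econt: "continuous_on {a..b} e"
      unfolding e_def using is_solutionD(1)[OF \<psi>] is_solutionD(1)[OF \<phi>] by (intro continuous_intros)
    have dr: "exp (L * (b - a)) * norm (y - x) < r" using y by (simp add: d_def field_simps)
    have inside: "e q < r" if small: "\<And>\<sigma>. \<sigma> \<in> {a..q} \<Longrightarrow> e \<sigma> \<le> r" and q: "q \<in> {a..b}" for q
    proof -
      have "e q \<le> exp (L * (q - a)) * norm (y - x)"
        unfolding e_def
      proof (rule solution_gronwall[OF \<phi> \<psi> _ L])
        show "a \<le> q" using q by simp
        fix \<sigma> assume "\<sigma> \<in> {a..q}"
        then show "norm (f \<sigma> (\<psi> \<sigma>) - f \<sigma> (\<phi> \<sigma>)) \<le> L * norm (\<psi> \<sigma> - \<phi> \<sigma>)"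
          using small[of \<sigma>] q r by (intro lip') (auto simp: e_def)
      qed
      also have "\<dots> \<le> exp (L * (b - a)) * norm (y - x)"
        using q L by (intro mult_right_mono) (auto intro!: mult_left_mono)
      finally show ?thesis using dr by simp
    qed
    \<comment> \<open>Continuation argument. At the first time \<open>q\<close> with
      \<open>e q\<close> at least \<open>r\<close>, the intermediate value theorem gives equality,
      so \<open>e\<close> is at most \<open>r\<close> up to \<open>q\<close>; then
      \<open>inside\<close> forces the strict inequality at \<open>q\<close>, a
      contradiction.\<close>
    have "e t < r"
    proof (rule ccontr)
      assume "\<not> e t < r"
      then have ne: "{t \<in> {a..b}. r \<le> e t} \<noteq> {}" using t by auto
      have "closed {t \<in> {a..b}. r \<le> e t}"
        using econt by (intro continuous_on_closed_Collect_le continuous_intros) auto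
      then have "compact ({a..b} \<inter> {t \<in> {a..b}. r \<le> e t})" by (intro compact_Int_closed) auto
      moreover have "{a..b} \<inter> {t \<in> {a..b}. r \<le> e t} = {t \<in> {a..b}. r \<le> e t}" by auto
      ultimately obtain q where q: "q \<in> {a..b}" "r \<le> e q" "\<And>p. p \<in> {a..b} \<Longrightarrow> r \<le> e p \<Longrightarrow> q \<le> p"
        using compact_attains_inf[OF _ ne] by auto
      have "e a < r"
      proof -
        have "1 * norm (y - x) \<le> exp (L * (b - a)) * norm (y - x)"
          using L ab by (intro mult_right_mono) auto
        then show ?thesis
          using dr is_solutionD(2)[OF \<phi>] is_solutionD(2)[OF \<psi>] by (simp add: e_def)
      qed
      then obtain p where p: "a \<le> p" "p \<le> q" "e p = r"
        using IVT'[of e a r q] q continuous_on_subset[OF econt, of "{a..q}"] by auto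
      then have "e q = r" using q(3)[of p] q(1) by auto
      then have "e \<sigma> \<le> r" if "\<sigma> \<in> {a..q}" for \<sigma>
        using q(3)[of \<sigma>] that q(1) by (cases "\<sigma> = q") force+
      then show False using inside[of q] q by auto
    qed
    then show ?thesis by (simp add: e_def)
  qed
  show thesis
  proof (rule that)
    show "d > 0" using r by (simp add: d_def)
    show "L \<ge> 0" by fact
    show "\<exists>r>0. L-lipschitz_on (cball (\<phi> t) r) (f t)" if "t \<in> {a..b}" for t using lip[OF that] r by blast
    fix y z \<psi> \<theta> t
    assume *: "norm (y - x) < d" "norm (z - x) < d" "is_solution f a y \<psi>" "is_solution f a z \<theta>"
      and t: "t \<in> {a..b}"
    have f: "norm (f \<sigma> (\<psi> \<sigma>) - f \<sigma> (\<theta> \<sigma>)) \<le> L * norm (\<psi> \<sigma> - \<theta> \<sigma>)" if "\<sigma> \<in> {a..b}" for \<sigma>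
      using stay[OF *(1,3) that] stay[OF *(2,4) that] that by (intro lip') auto
    have "norm (\<psi> t - \<theta> t) \<le> exp (L * (t - a)) * norm (y - z)"
      using t f by (intro solution_gronwall[OF *(4,3) _ L]) auto
    also have "\<dots> \<le> exp (L * (b - a)) * norm (y - z)"
      using t L by (intro mult_right_mono) (auto intro!: mult_left_mono)
    finally show "norm (\<psi> t - \<theta> t) \<le> exp (L * (b - a)) * norm (y - z) \<and>
      norm (f t (\<psi> t) - f t (\<theta> t)) \<le> L * norm (\<psi> t - \<theta> t)" using f[OF t] by blast
  qed
qed

lemma is_solution_unique:
  assumes \<phi>: "is_solution f a x \<phi>" and \<psi>: "is_solution f a x \<psi>" and "t0 \<le> a" "a \<le> t"
  shows "\<psi> t = \<phi> t"
proof (rule local_dependence[OF \<phi> assms(3,4)])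
  fix d L assume "d > 0" and dep: "\<And>y z \<psi> \<theta> q. norm (y - x) < d \<Longrightarrow> norm (z - x) < d \<Longrightarrow>
      is_solution f a y \<psi> \<Longrightarrow> is_solution f a z \<theta> \<Longrightarrow> q \<in> {a..t} \<Longrightarrow>
      norm (\<psi> q - \<theta> q) \<le> exp (L * (t - a)) * norm (y - z) \<and>
      norm (f q (\<psi> q) - f q (\<theta> q)) \<le> L * norm (\<psi> q - \<theta> q)"
  show ?thesis using dep[OF _ _ \<psi> \<phi>, of t] \<open>d > 0\<close> \<open>a \<le> t\<close> by simp
qed

lemma flow_eq:
  assumes "is_solution f a x \<phi>" "t0 \<le> a" "a \<le> t"
  shows "flow f t a x = \<phi> t"
  unfolding flow_def
proof (rule the_equality)
  show "\<exists>\<psi>. is_solution f a x \<psi> \<and> \<phi> t = \<psi> t" using assms by blast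
  show "y = \<phi> t" if "\<exists>\<psi>. is_solution f a x \<psi> \<and> y = \<psi> t" for y
    using that is_solution_unique assms by blast
qed

lemma flow_solution:
  assumes "t0 \<le> a"
  obtains \<phi> where "is_solution f a x \<phi>" "\<And>t. a \<le> t \<Longrightarrow> flow f t a x = \<phi> t"
proof -
  obtain \<phi> where "is_solution f a x \<phi>"
    using complete assms unfolding forward_complete_def by blast
  then show thesis using that flow_eq assms by blast
qed

lemma flow_is_solution:
  assumes "t0 \<le> a"
  shows "is_solution f a x (\<lambda>t. flow f t a x)"
proof -
  obtain \<phi> where \<phi>: "is_solution f a x \<phi>" "\<And>t. a \<le> t \<Longrightarrow> flow f t a x = \<phi> t"
    using flow_solution[OF assms] by blast
  show ?thesis
    unfolding is_solution_def
  proof (intro conjI allI impI)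
    have "continuous_on {a..} \<phi>" using \<phi>(1) by (simp add: is_solution_def)
    then show "continuous_on {a..} (\<lambda>t. flow f t a x)"
      by (rule continuous_on_eq) (simp add: \<phi>(2))
    fix t assume "a \<le> t"
    then have "((\<lambda>\<tau>. f \<tau> (\<phi> \<tau>)) has_integral \<phi> t - x) {a..t}"
      using \<phi>(1) by (simp add: is_solution_def)
    then have "((\<lambda>\<tau>. f \<tau> (flow f \<tau> a x)) has_integral \<phi> t - x) {a..t}"
      by (rule has_integral_eq[rotated]) (simp add: \<phi>(2))
    then show "((\<lambda>\<tau>. f \<tau> (flow f \<tau> a x)) has_integral flow f t a x - x) {a..t}"
      using \<phi>(2) \<open>a \<le> t\<close> by simp
  qed
qed

lemma flow_flow:
  assumes "t0 \<le> a" "a \<le> b" "b \<le> t"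
  shows "flow f t a x = flow f t b (flow f b a x)"
proof -
  obtain \<phi> where \<phi>: "is_solution f a x \<phi>" "\<And>t. a \<le> t \<Longrightarrow> flow f t a x = \<phi> t"
    using flow_solution[OF assms(1)] by blast
  have "flow f t b (\<phi> b) = \<phi> t"
    using is_solution_shift[OF \<phi>(1)] assms by (intro flow_eq) auto
  then show ?thesis using \<phi>(2) assms by simp
qed

lemma flow_local_lipschitz:
  assumes "t0 \<le> a" "a \<le> b"
  obtains d L where "d > 0" "L \<ge> 0"
    "\<And>y z t. norm (y - x) < d \<Longrightarrow> norm (z - x) < d \<Longrightarrow> t \<in> {a..b} \<Longrightarrow>
      norm (flow f t a y - flow f t a z) \<le> exp (L * (b - a)) * norm (y - z) \<and>
      norm (f t (flow f t a y) - f t (flow f t a z)) \<le> L * norm (flow f t a y - flow f t a z)"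
    "\<And>t. t \<in> {a..b} \<Longrightarrow> \<exists>r>0. L-lipschitz_on (cball (flow f t a x) r) (f t)"
proof -
  obtain \<phi> where \<phi>: "is_solution f a x \<phi>" "\<And>t. a \<le> t \<Longrightarrow> flow f t a x = \<phi> t"
    using flow_solution[OF assms(1)] by blast
  obtain d L where dL: "d > 0" "L \<ge> 0"
    "\<And>y z \<psi> \<theta> t. norm (y - x) < d \<Longrightarrow> norm (z - x) < d \<Longrightarrow>
      is_solution f a y \<psi> \<Longrightarrow> is_solution f a z \<theta> \<Longrightarrow> t \<in> {a..b} \<Longrightarrow>
      norm (\<psi> t - \<theta> t) \<le> exp (L * (b - a)) * norm (y - z) \<and>
      norm (f t (\<psi> t) - f t (\<theta> t)) \<le> L * norm (\<psi> t - \<theta> t)"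
    "\<And>t. t \<in> {a..b} \<Longrightarrow> \<exists>r>0. L-lipschitz_on (cball (\<phi> t) r) (f t)"
    using local_dependence[OF \<phi>(1) assms] by metis
  show thesis
  proof (rule that[OF dL(1,2)])
    fix y z t assume yz: "norm (y - x) < d" "norm (z - x) < d" "t \<in> {a..b}"
    obtain \<psi> where \<psi>: "is_solution f a y \<psi>" "\<And>t. a \<le> t \<Longrightarrow> flow f t a y = \<psi> t"
      using flow_solution[OF assms(1)] by blast
    obtain \<theta> where \<theta>: "is_solution f a z \<theta>" "\<And>t. a \<le> t \<Longrightarrow> flow f t a z = \<theta> t"
      using flow_solution[OF assms(1)] by blast
    show "norm (flow f t a y - flow f t a z) \<le> exp (L * (b - a)) * norm (y - z) \<and>
      norm (f t (flow f t a y) - f t (flow f t a z)) \<le> L * norm (flow f t a y - flow f t a z)"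
      using dL(3)[OF yz(1,2) \<psi>(1) \<theta>(1) yz(3)] \<psi>(2) \<theta>(2) yz by auto
  next
    show "\<exists>r>0. L-lipschitz_on (cball (flow f t a x) r) (f t)" if "t \<in> {a..b}" for t
      using dL(4)[OF that] \<phi>(2) that by auto
  qed
qed

text \<open>Finitely many of the local neighbourhoods cover \<open>C\<close>. The largest of their
  constants is a local constant at every point of \<open>C\<close>, and convexity lets
  \<open>segment_bound\<close> make it global.\<close>

lemma flow_lipschitz_compact:
  assumes ab: "t0 \<le> a" "a \<le> b" and C: "compact C" "convex C"
  obtains \<Lambda> where "\<Lambda> > 0"
    "\<And>x y t. x \<in> C \<Longrightarrow> y \<in> C \<Longrightarrow> t \<in> {a..b} \<Longrightarrow>
      norm (flow f t a y - flow f t a x) \<le> \<Lambda> * norm (y - x)"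
proof -
  have "\<exists>d>0. \<exists>\<Lambda>>0. \<forall>y z t. norm (y - x) < d \<longrightarrow> norm (z - x) < d \<longrightarrow> t \<in> {a..b} \<longrightarrow>
      norm (flow f t a y - flow f t a z) \<le> \<Lambda> * norm (y - z)" for x
    using flow_local_lipschitz[OF ab, of x] by (metis exp_gt_zero)
  then obtain d \<Lambda> where d: "\<And>x. d x > 0" and \<Lambda>: "\<And>x. \<Lambda> x > 0"
    and lip: "\<And>x y z t. norm (y - x) < d x \<Longrightarrow> norm (z - x) < d x \<Longrightarrow> t \<in> {a..b} \<Longrightarrow>
      norm (flow f t a y - flow f t a z) \<le> \<Lambda> x * norm (y - z)" by metis
  obtain F where F: "finite F" "F \<subseteq> C" "C \<subseteq> (\<Union>x\<in>F. ball x (d x))"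
  proof (rule compactE_image[OF C(1), of C "\<lambda>x. ball x (d x)"])
    show "C \<subseteq> (\<Union>x\<in>C. ball x (d x))" using d by force
  qed auto
  \<comment> \<open>Inserting 1 keeps the maximum defined and positive when the cover is
    empty.\<close>
  define B where "B = Max (insert 1 (\<Lambda> ` F))"
  have B: "\<Lambda> x \<le> B" if "x \<in> F" for x using that F by (simp add: B_def)
  show thesis
  proof
    show "B > 0" using F by (auto simp: B_def intro: less_le_trans[OF zero_less_one])
    fix x y t assume xy: "x \<in> C" "y \<in> C" and t: "t \<in> {a..b}"
    show "norm (flow f t a y - flow f t a x) \<le> B * norm (y - x)"
    proof (rule euclid.segment_bound[OF C(2) xy])
      fix v assume "v \<in> C"
      then obtain z where z: "z \<in> F" "norm (v - z) < d z"
        using F by (auto simp: dist_norm norm_minus_commute)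
      show "\<exists>e>0. \<forall>w\<in>C. norm (w - v) < e \<longrightarrow> norm (flow f t a w - flow f t a v) \<le> B * norm (w - v)"
      proof (intro exI conjI ballI impI)
        \<comment> \<open>With this radius \<open>w\<close> lies, like \<open>v\<close>, in the
          neighbourhood of the centre \<open>z\<close>, where any two points may be
          compared.\<close>
        show "d z - norm (v - z) > 0" using z by simp
        fix w assume "norm (w - v) < d z - norm (v - z)"
        then have "norm (w - z) < d z" using norm_triangle_ineq[of "w - v" "v - z"] by simp
        then have "norm (flow f t a w - flow f t a v) \<le> \<Lambda> z * norm (w - v)" using lip z t by blast
        also have "\<dots> \<le> B * norm (w - v)" using B[OF z(1)] by (intro mult_right_mono) auto
        finally show "norm (flow f t a w - flow f t a v) \<le> B * norm (w - v)" .
      qed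
    qed
  qed
qed

end

section \<open>Growth along trajectories\<close>

text \<open>Applying \<open>A\<close> to unit vectors bounds each entry by \<open>L\<close>. This
  turns an operator bound into the Frobenius bound that \<open>uniform_step\<close> asks for; the
  dimensional factors are harmless there.\<close>

lemma norm_matrix_le:
  fixes A :: "real ^ 'n ^ 'm"
  assumes "\<And>z. norm (A *v z) \<le> L * norm z"
  shows "norm A \<le> real CARD('m) * (real CARD('n) * L)"
proof -
  have c: "\<bar>A $ i $ j\<bar> \<le> L" for i j
  proof -
    have "A $ i $ j = (A *v axis j 1) $ i" by (simp add: matrix_vector_mult_basis column_def)
    then show ?thesis using component_le_norm_cart[of "A *v axis j 1" i] assms[of "axis j 1"] by simp
  qed
  have "norm (A $ i) \<le> real CARD('n) * L" for i
  proof -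
    have "norm (A $ i) \<le> (\<Sum>j\<in>UNIV. \<bar>A $ i $ j\<bar>)" by (rule norm_le_l1_cart)
    also have "\<dots> \<le> of_nat CARD('n) * L" by (intro sum_bounded_above c)
    finally show ?thesis by simp
  qed
  then have "(\<Sum>i\<in>UNIV. norm (A $ i)) \<le> of_nat CARD('m) * (real CARD('n) * L)"
    by (intro sum_bounded_above)
  moreover have "norm A \<le> (\<Sum>i\<in>UNIV. norm (A $ i))"
    unfolding norm_vec_def by (intro L2_set_le_sum) simp
  ultimately show ?thesis by simp
qed

text \<open>The derivative in direction \<open>z\<close> is approximated by difference quotients,
  which the Lipschitz constant bounds. Along a trajectory this bounds all Jacobians by the constant
  of the tube.\<close>

lemma lipschitz_derivative_bound:
  fixes F :: "'a::real_normed_vector \<Rightarrow> 'b::real_normed_vector"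
  assumes F: "(F has_derivative F') (at x)" and lip: "L-lipschitz_on (cball x r) F" and "r > 0"
  shows "norm (F' z) \<le> L * norm z"
proof (cases "z = 0")
  case True
  then show ?thesis using has_derivative_bounded_linear[OF F] linear_0 bounded_linear.linear by fastforce
next
  case False
  show ?thesis
  proof (rule field_le_epsilon)
    fix e :: real assume e: "e > 0"
    have "e / norm z > 0" using e False by simp
    then obtain d where d: "d > 0"
      "\<And>y. norm (y - x) < d \<Longrightarrow> norm (F y - F x - F' (y - x)) \<le> e / norm z * norm (y - x)"
      using F unfolding has_derivative_at_alt by blast
    \<comment> \<open>Small enough for the differentiability estimate and for staying in the ball
      where \<open>F\<close> is Lipschitz.\<close>
    define s where "s = min d r / (2 * norm z)"
    have s: "s > 0" "s * norm z < d" "s * norm z < r"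
      using d \<open>r > 0\<close> False by (auto simp: s_def field_simps min_def)
    have "norm (F (x + s *\<^sub>R z) - F x) \<le> L * (s * norm z)"
      using lipschitz_onD[OF lip, of "x + s *\<^sub>R z" x] s \<open>r > 0\<close> by (simp add: dist_norm)
    moreover have "norm (F (x + s *\<^sub>R z) - F x - s *\<^sub>R F' z) \<le> e * s"
      using d(2)[of "x + s *\<^sub>R z"] s False
      by (simp add: linear_scale[OF bounded_linear.linear[OF has_derivative_bounded_linear[OF F]]])
    ultimately have "norm (s *\<^sub>R F' z) \<le> s * (L * norm z + e)"
      using norm_triangle_sub[of "s *\<^sub>R F' z" "F (x + s *\<^sub>R z) - F x"]
      by (simp add: norm_minus_commute algebra_simps)
    then show "norm (F' z) \<le> L * norm z + e" using s by simp
  qed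
qed

text \<open>One Euler step. Writing \<open>u k t\<close> as the average of \<open>u k s + (t - s) *\<^sub>R g k \<sigma>\<close> over \<open>\<sigma>\<close>
  avoids differentiating \<open>u k\<close>, and the truncated defect \<open>\<rho>\<close> is measurable although the matrices
  \<open>A \<sigma>\<close> need not be measurable in \<open>\<sigma>\<close>.\<close>

lemma (in vector_norm) growth_step:
  fixes u g :: "nat \<Rightarrow> real \<Rightarrow> real ^ 'n" and A :: "real \<Rightarrow> real ^ 'n ^ 'n"
  assumes "s < t"
    and int: "\<And>k q. s \<le> q \<Longrightarrow> q \<le> t \<Longrightarrow> (g k has_integral (u k q - u k s)) {s..q}"
    and bd: "\<And>k \<sigma>. \<sigma> \<in> {s..t} \<Longrightarrow> norm (g k \<sigma>) \<le> G"
    and lin: "\<And>\<sigma> z. \<sigma> \<in> {s..t} \<Longrightarrow> norm (A \<sigma> *v z) \<le> L * norm z"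
    and app: "\<And>\<sigma>. \<sigma> \<in> {s..t} \<Longrightarrow> (\<lambda>k. g k \<sigma> - A \<sigma> *v u k \<sigma>) \<longlonglongrightarrow> 0"
    and step: "\<And>\<sigma> z. \<sigma> \<in> {s..t} \<Longrightarrow> M (z + (t - s) *\<^sub>R (A \<sigma> *v z)) \<le> (1 + (t - s) * c) * M z"
    and "0 \<le> c" and "0 \<le> L" and C: "0 \<le> C" "\<And>x. M x \<le> C * norm x" and "e > 0"
  shows "\<forall>\<^sub>F k in sequentially. M (u k t) \<le> (1 + (t - s) * c) * M (u k s) + (C * L * G * (t - s)^2 + e)"
proof -
  define h where "h = t - s"
  have h: "h > 0" using \<open>s < t\<close> by (simp add: h_def)
  define \<kappa> where "\<kappa> = C * L * G"
  have G: "0 \<le> G" using order_trans[OF norm_ge_zero bd[of s 0]] \<open>s < t\<close> by simp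
  then have \<kappa>: "\<kappa> \<ge> 0" using C \<open>0 \<le> L\<close> by (simp add: \<kappa>_def)
  have MC: "M x \<le> C * B" if "norm x \<le> B" for x B
    using C mult_left_mono[OF that C(1)] order_trans by blast
  have incr: "norm (u k \<sigma> - u k s) \<le> G * h" if "\<sigma> \<in> {s..t}" for k \<sigma>
  proof -
    have "norm (u k \<sigma> - u k s) \<le> (\<sigma> - s) *\<^sub>R G"
      using that bd has_integral_const_real[of G s \<sigma>]
      by (intro euclid.integral_le[OF int[of \<sigma> k]]) auto
    also have "\<dots> \<le> G * h" using that G by (simp add: h_def mult.commute mult_left_mono)
    finally show ?thesis .
  qed
  \<comment> \<open>The excess, per unit of \<open>h\<close>, of a step with frozen velocity
    \<open>g k \<sigma>\<close> over the growth factor \<open>1 + h * c\<close>.\<close>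
  define d where "d k \<sigma> = (M (u k s + h *\<^sub>R g k \<sigma>) - (1 + h * c) * M (u k s)) / h" for k \<sigma>
  \<comment> \<open>The term \<open>\<kappa> * h\<close> pays for applying \<open>A \<sigma>\<close>
    to \<open>u k s\<close> in place of \<open>u k \<sigma>\<close>, two vectors at distance at most
    \<open>G * h\<close>. What is left is dominated by the remainder in \<open>app\<close> and tends
    to zero.\<close>
  define \<rho> where "\<rho> k \<sigma> = max 0 (d k \<sigma> - \<kappa> * h)" for k \<sigma>
  have d1: "d k \<sigma> \<le> C * G" if "\<sigma> \<in> {s..t}" for k \<sigma>
  proof -
    have "M (u k s + h *\<^sub>R g k \<sigma>) \<le> M (u k s) + h * M (g k \<sigma>)"
      using triangle[of "u k s" "h *\<^sub>R g k \<sigma>"] h by (simp add: scale)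
    also have "\<dots> \<le> M (u k s) + h * (C * G)"
      using h MC[OF bd[OF that]] by (intro add_left_mono mult_left_mono) auto
    also have "\<dots> \<le> (1 + h * c) * M (u k s) + h * (C * G)"
      using h \<open>0 \<le> c\<close> by (simp add: algebra_simps)
    finally show ?thesis using h by (simp add: d_def divide_simps mult.commute)
  qed
  have d2: "d k \<sigma> - \<kappa> * h \<le> M (g k \<sigma> - A \<sigma> *v u k \<sigma>)" if "\<sigma> \<in> {s..t}" for k \<sigma>
  proof -
    let ?p = "u k s + h *\<^sub>R (A \<sigma> *v u k s)" and ?q = "A \<sigma> *v (u k \<sigma> - u k s)"
      and ?r = "g k \<sigma> - A \<sigma> *v u k \<sigma>"
    have "u k s + h *\<^sub>R g k \<sigma> = ?p + h *\<^sub>R ?q + h *\<^sub>R ?r"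
      by (simp add: matrix_vector_mult_diff_distrib algebra_simps)
    then have "M (u k s + h *\<^sub>R g k \<sigma>) \<le> M ?p + h * M ?q + h * M ?r"
      using triangle[of "?p + h *\<^sub>R ?q" "h *\<^sub>R ?r"] triangle[of ?p "h *\<^sub>R ?q"] h
      by (simp only: scale abs_of_pos)
    moreover have "M ?p \<le> (1 + h * c) * M (u k s)" unfolding h_def by (rule step[OF that])
    moreover have "M ?q \<le> C * (L * (G * h))"
      using lin[OF that, of "u k \<sigma> - u k s"] mult_left_mono[OF incr[OF that, of k] \<open>0 \<le> L\<close>]
      by (intro MC) auto
    then have "h * M ?q \<le> h * (\<kappa> * h)" using h by (simp add: \<kappa>_def mult.assoc)
    ultimately have "M (u k s + h *\<^sub>R g k \<sigma>) - (1 + h * c) * M (u k s) \<le> h * (\<kappa> * h + M ?r)"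
      unfolding distrib_left[of h "\<kappa> * h" "M ?r"] by linarith
    then have "d k \<sigma> \<le> \<kappa> * h + M ?r"
      using h unfolding d_def by (simp add: pos_divide_le_eq mult.commute)
    then show ?thesis by simp
  qed
  have \<rho>: "0 \<le> \<rho> k \<sigma>" for k \<sigma> by (simp add: \<rho>_def)
  have \<rho>_bd: "norm (\<rho> k \<sigma>) \<le> C * G" if "\<sigma> \<in> {s..t}" for k \<sigma>
  proof -
    have "0 \<le> \<kappa> * h" "0 \<le> C * G" using \<kappa> h C G by auto
    then show ?thesis using d1[OF that, of k] by (simp add: \<rho>_def)
  qed
  have \<rho>_lim: "(\<lambda>k. \<rho> k \<sigma>) \<longlonglongrightarrow> 0" if \<sigma>: "\<sigma> \<in> {s..t}" for \<sigma>
  proof (rule tendsto_sandwich[where f = "\<lambda>_. 0" and h = "\<lambda>k. M (g k \<sigma> - A \<sigma> *v u k \<sigma>)"])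
    have "isCont M 0" using continuous_on_norm[of UNIV] by (simp add: continuous_on_eq_continuous_at)
    then have "(\<lambda>k. M (g k \<sigma> - A \<sigma> *v u k \<sigma>)) \<longlonglongrightarrow> M 0"
      using app[OF \<sigma>] by (rule isCont_tendsto_compose)
    then show "(\<lambda>k. M (g k \<sigma> - A \<sigma> *v u k \<sigma>)) \<longlonglongrightarrow> 0" by simp
    show "\<forall>\<^sub>F k in sequentially. \<rho> k \<sigma> \<le> M (g k \<sigma> - A \<sigma> *v u k \<sigma>)"
      using d2[OF \<sigma>] by (simp add: \<rho>_def)
  qed (use \<rho> in auto)
  have \<rho>_int: "\<rho> k integrable_on {s..t}" for k
  proof (rule measurable_bounded_by_integrable_imp_integrable)
    have "g k integrable_on {s..t}" using int[of t k] \<open>s < t\<close> by auto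
    then have [measurable]: "g k \<in> borel_measurable (lebesgue_on {s..t})"
      by (rule integrable_imp_measurable)
    have [measurable]: "M \<in> borel_measurable borel"
      using continuous_on_norm by (rule borel_measurable_continuous_onI)
    show "\<rho> k \<in> borel_measurable (lebesgue_on {s..t})"
      unfolding \<rho>_def[abs_def] d_def by measurable
    show "(\<lambda>_. C * G) integrable_on {s..t}" by (rule integrable_const_ivl)
  qed (use \<rho>_bd in auto)
  have "(\<lambda>k. integral {s..t} (\<rho> k)) \<longlonglongrightarrow> integral {s..t} (\<lambda>_. 0)"
    using \<rho>_int \<rho>_bd \<rho>_lim by (intro dominated_convergence(2)[where h = "\<lambda>_. C * G"]) auto
  \<comment> \<open>Only the integral of the defect over the step has to be small, so pointwise
    convergence without uniformity in time is enough.\<close>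
  then have "\<forall>\<^sub>F k in sequentially. integral {s..t} (\<rho> k) < e"
    using \<open>e > 0\<close> by (auto dest: order_tendstoD(2))
  then show ?thesis
  proof eventually_elim
    case (elim k)
    let ?b = "(1 + h * c) * M (u k s) + \<kappa> * h^2"
    have "((\<lambda>\<sigma>. u k s + h *\<^sub>R g k \<sigma>) has_integral (t - s) *\<^sub>R u k s + h *\<^sub>R (u k t - u k s)) {s..t}"
      using int[of t k] \<open>s < t\<close> has_integral_const_real[of "u k s" s t]
      by (intro has_integral_add has_integral_cmul) auto
    moreover have "((\<lambda>\<sigma>. ?b + h * \<rho> k \<sigma>) has_integral (t - s) *\<^sub>R ?b + h * integral {s..t} (\<rho> k)) {s..t}"
      using \<rho>_int[of k] \<open>s < t\<close> has_integral_const_real[of ?b s t]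
      by (intro has_integral_add has_integral_mult_right integrable_integral) auto
    moreover have "M (u k s + h *\<^sub>R g k \<sigma>) \<le> ?b + h * \<rho> k \<sigma>" for \<sigma>
    proof -
      have "h * (d k \<sigma> - \<kappa> * h) \<le> h * \<rho> k \<sigma>" using h by (simp add: \<rho>_def)
      moreover have "h * d k \<sigma> = M (u k s + h *\<^sub>R g k \<sigma>) - (1 + h * c) * M (u k s)"
        using h by (simp add: d_def)
      ultimately show ?thesis by (simp add: algebra_simps power2_eq_square)
    qed
    ultimately have "M ((t - s) *\<^sub>R u k s + h *\<^sub>R (u k t - u k s)) \<le> (t - s) *\<^sub>R ?b + h * integral {s..t} (\<rho> k)"
      by (rule integral_le)
    then have "h * M (u k t) \<le> h * (?b + integral {s..t} (\<rho> k))"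
      using h by (simp add: h_def[symmetric] scale scaleR_diff_right distrib_left)
    then have "M (u k t) \<le> ?b + integral {s..t} (\<rho> k)" using h by simp
    then show ?case using elim by (simp add: h_def[symmetric] \<kappa>_def[symmetric])
  qed
qed

text \<open>The interval is cut into \<open>n\<close> steps with \<open>n\<close> independent of
  \<open>k\<close>, so only finitely many eventual statements from \<open>growth_step\<close> are
  combined. Each step errs by order \<open>h^2\<close>, which sums to order \<open>h\<close>, and
  the growth factors multiply to at most the exponential.\<close>

lemma (in vector_norm) growth:
  fixes u g :: "nat \<Rightarrow> real \<Rightarrow> real ^ 'n" and A :: "real \<Rightarrow> real ^ 'n ^ 'n"
  assumes "a \<le> b"
    and int: "\<And>k p q. a \<le> p \<Longrightarrow> p \<le> q \<Longrightarrow> q \<le> b \<Longrightarrow> (g k has_integral (u k q - u k p)) {p..q}"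
    and bd: "\<And>k \<sigma>. \<sigma> \<in> {a..b} \<Longrightarrow> norm (g k \<sigma>) \<le> G"
    and lin: "\<And>\<sigma> z. \<sigma> \<in> {a..b} \<Longrightarrow> norm (A \<sigma> *v z) \<le> L * norm z"
    and app: "\<And>\<sigma>. \<sigma> \<in> {a..b} \<Longrightarrow> (\<lambda>k. g k \<sigma> - A \<sigma> *v u k \<sigma>) \<longlonglongrightarrow> 0"
    and step: "\<And>\<sigma> h z. \<sigma> \<in> {a..b} \<Longrightarrow> 0 < h \<Longrightarrow> h \<le> h0 \<Longrightarrow>
      M (z + h *\<^sub>R (A \<sigma> *v z)) \<le> (1 + h * c) * M z"
    and "h0 > 0" and "0 \<le> c" and "0 \<le> L" and "e > 0"
  shows "\<forall>\<^sub>F k in sequentially. M (u k b) \<le> exp (c * (b - a)) * (M (u k a) + e)"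
proof (cases "a = b")
  case True
  then show ?thesis using \<open>e > 0\<close> by simp
next
  case False
  then have ab: "a < b" using \<open>a \<le> b\<close> by simp
  obtain C where C: "C > 0" "\<And>x. M x \<le> C * norm x" using le_norm by blast
  define \<kappa> where "\<kappa> = C * L * G"
  have "0 \<le> G" using order_trans[OF norm_ge_zero bd[of a 0]] ab by simp
  then have \<kappa>: "0 \<le> \<kappa>" using C \<open>0 \<le> L\<close> by (simp add: \<kappa>_def)
  \<comment> \<open>The second bound on the step makes the accumulated error
    \<open>(b - a) * (\<kappa> + 1) * h\<close> at most \<open>e\<close>; the first admits the step
    in the hypothesis on \<open>A\<close>.\<close>
  define \<delta> where "\<delta> = min h0 (e / ((b - a) * (\<kappa> + 1)))"
  have \<delta>: "\<delta> > 0" using \<open>h0 > 0\<close> \<open>e > 0\<close> ab \<kappa> by (simp add: \<delta>_def)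
  obtain n :: nat where n: "(b - a) / \<delta> < real n" using reals_Archimedean2 by blast
  have n0: "n > 0" using n ab \<delta> by (cases n) (auto simp: field_simps)
  define h where "h = (b - a) / real n"
  have h: "0 < h" "h \<le> \<delta>" "real n * h = b - a"
    using n n0 ab \<delta> by (auto simp: h_def field_simps)
  \<comment> \<open>Error of one step: the consistency error of \<open>growth_step\<close>, plus the
    tolerance, for which \<open>h^2\<close> is chosen so that both have the same order.\<close>
  define \<eta> where "\<eta> = \<kappa> * h^2 + h^2"
  have \<eta>: "0 \<le> \<eta>" using \<kappa> by (simp add: \<eta>_def)
  have n\<eta>: "real n * \<eta> \<le> e"
  proof -
    have "real n * \<eta> = (real n * h) * (\<kappa> + 1) * h"
      by (simp add: \<eta>_def algebra_simps power2_eq_square)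
    also have "\<dots> = (b - a) * (\<kappa> + 1) * h" by (simp add: h)
    also have "\<dots> \<le> (b - a) * (\<kappa> + 1) * (e / ((b - a) * (\<kappa> + 1)))"
      using h(2) ab \<kappa> by (intro mult_left_mono) (auto simp: \<delta>_def)
    also have "\<dots> = e" using ab \<kappa> by simp
    finally show ?thesis .
  qed
  have "\<forall>\<^sub>F k in sequentially. M (u k (a + real i * h)) \<le> (1 + h * c) ^ i * (M (u k a) + real i * \<eta>)"
    if "i \<le> n" for i
    using that
  proof (induction i)
    case (Suc i)
    define s t where st: "s = a + real i * h" "t = a + real (Suc i) * h"
    have ts: "t - s = h" by (simp add: st algebra_simps)
    have "real (Suc i) * h \<le> real n * h" using Suc.prems h by (intro mult_right_mono) auto
    then have sub: "{s..t} \<subseteq> {a..b}" using h by (auto simp: st algebra_simps)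
    have "h > 0" "a \<le> s" "t \<le> b" "s < t" "h \<le> h0" using h sub by (auto simp: \<delta>_def st algebra_simps)
    then have "\<forall>\<^sub>F k in sequentially. M (u k t) \<le> (1 + (t - s) * c) * M (u k s) + (C * L * G * (t - s)^2 + h^2)"
      using bd lin app step \<open>0 \<le> c\<close> \<open>0 \<le> L\<close> C sub
      by (intro growth_step[where g = g and A = A] int) (auto simp: ts subset_iff)
    moreover have "\<forall>\<^sub>F k in sequentially. M (u k s) \<le> (1 + h * c) ^ i * (M (u k a) + real i * \<eta>)"
      using Suc by (simp add: st)
    ultimately show ?case
      unfolding st(2)[symmetric]
    proof eventually_elim
      case (elim k)
      \<comment> \<open>As the growth factor is at least 1, the newest error can be placed under the
        full power together with the older ones.\<close>
      have c1: "1 \<le> 1 + h * c" using h \<open>0 \<le> c\<close> by simp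
      have "M (u k t) \<le> (1 + h * c) * M (u k s) + \<eta>"
        using elim(1) by (simp only: ts \<eta>_def \<kappa>_def)
      also have "\<dots> \<le> (1 + h * c) * ((1 + h * c) ^ i * (M (u k a) + real i * \<eta>)) + (1 + h * c) ^ Suc i * \<eta>"
        using elim(2) c1 mult_right_mono[OF one_le_power[OF c1, of "Suc i"] \<eta>]
        by (intro add_mono mult_left_mono) auto
      also have "\<dots> = (1 + h * c) ^ Suc i * (M (u k a) + real (Suc i) * \<eta>)"
        by (simp add: algebra_simps)
      finally show ?case .
    qed
  qed simp
  from this[of n] have "\<forall>\<^sub>F k in sequentially. M (u k b) \<le> (1 + h * c) ^ n * (M (u k a) + real n * \<eta>)"
    using h by simp
  then show ?thesis
  proof eventually_elim
    case (elim k)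
    have "(1 + h * c) ^ n \<le> exp (h * c) ^ n"
      using h \<open>0 \<le> c\<close> exp_ge_add_one_self by (intro power_mono) auto
    also have "\<dots> = exp (real n * h * c)" by (simp add: exp_of_nat_mult mult.assoc flip: exp_of_nat_mult)
    finally have "(1 + h * c) ^ n \<le> exp (c * (b - a))" by (simp add: h(3) mult.commute[of c])
    then have "(1 + h * c) ^ n * (M (u k a) + real n * \<eta>) \<le> exp (c * (b - a)) * (M (u k a) + e)"
      using n\<eta> \<eta> h \<open>0 \<le> c\<close> by (intro mult_mono) auto
    then show ?case using elim by simp
  qed
qed

section \<open>Growth of distances under the flow\<close>

locale normed_system = vector_norm M + complete_system f t0
  for M :: "real ^ 'n \<Rightarrow> real" and f :: "real \<Rightarrow> real ^ 'n \<Rightarrow> real ^ 'n" and t0 :: real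
begin

text \<open>If the estimate failed in every neighbourhood, there would be points \<open>w k\<close>
  tending to \<open>v\<close> that violate it. The differences of their trajectories from that of
  \<open>v\<close>, divided by the initial distance \<open>\<delta> k\<close>, satisfy the
  hypotheses of \<open>growth\<close> with \<open>A\<close> the Jacobian along the trajectory of
  \<open>v\<close>, and the resulting bound contradicts the violation.\<close>

lemma flow_growth_local:
  assumes t: "t0 \<le> t1" "t1 \<le> a" "a \<le> b" and v: "v \<in> C"
    and diff: "\<And>t. t \<in> {a..b} \<Longrightarrow> f t differentiable (at (flow f t t1 v))"
    and meas: "\<And>t. t \<in> {a..b} \<Longrightarrow> matrix_measure M (jacobian (f t) (at (flow f t t1 v))) \<le> c"
    and c: "c < c'" "0 \<le> c'" and "\<Lambda> > 0"
    and \<Lambda>: "\<And>w. w \<in> C \<Longrightarrow> M (flow f a t1 w - flow f a t1 v) \<le> \<Lambda> * M (w - v)"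
  shows "\<exists>d>0. \<forall>w\<in>C. norm (w - v) < d \<longrightarrow>
    M (flow f b t1 w - flow f b t1 v) \<le> (2 * \<Lambda> * exp (c' * (b - a))) * M (w - v)"
proof (rule ccontr)
  \<comment> \<open>The factor 2 makes room for the tolerance of \<open>growth\<close>, which is
    taken to be \<Lambda> and added to the initial bound \<Lambda>.\<close>
  define B where "B = 2 * \<Lambda> * exp (c' * (b - a))"
  assume "\<not> ?thesis"
  then have contra: "\<exists>w\<in>C. norm (w - v) < d \<and> B * M (w - v) < M (flow f b t1 w - flow f b t1 v)"
    if "d > 0" for d using that by (auto simp: B_def not_le)
  obtain D where D: "D > 0" "\<And>x. norm x \<le> D * M x" using norm_le by blast
  have "t1 \<le> b" using t by simp
  then obtain d L where d: "d > 0" and L: "L \<ge> 0" and dep: "\<And>y z t. norm (y - v) < d \<Longrightarrow> norm (z - v) < d \<Longrightarrow> t \<in> {t1..b} \<Longrightarrow>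
      norm (flow f t t1 y - flow f t t1 z) \<le> exp (L * (b - t1)) * norm (y - z) \<and>
      norm (f t (flow f t t1 y) - f t (flow f t t1 z)) \<le> L * norm (flow f t t1 y - flow f t t1 z)"
    and lip: "\<And>t. t \<in> {t1..b} \<Longrightarrow> \<exists>r>0. L-lipschitz_on (cball (flow f t t1 v) r) (f t)"
    using flow_local_lipschitz[OF t(1), of b v] by metis
  define E where "E = exp (L * (b - t1))"
  have "\<exists>w\<in>C. norm (w - v) < min d (1 / real (Suc k)) \<and> B * M (w - v) < M (flow f b t1 w - flow f b t1 v)" for k
    using d by (intro contra) auto
  then obtain w where w: "\<And>k. w k \<in> C" "\<And>k. norm (w k - v) < d" "\<And>k. norm (w k - v) < 1 / real (Suc k)"
    "\<And>k. B * M (w k - v) < M (flow f b t1 (w k) - flow f b t1 v)"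
    by (metis min_less_iff_conj)
  define \<delta> where "\<delta> k = M (w k - v)" for k
  have \<delta>: "\<delta> k > 0" for k
  proof -
    \<comment> \<open>At \<open>v\<close> itself both sides of the strict inequality vanish.\<close>
    have "w k \<noteq> v" using w(4)[of k] by auto
    then show ?thesis using nonneg[of "w k - v"] eq_0_iff[of "w k - v"] unfolding \<delta>_def
      by (metis less_eq_real_def right_minus_eq)
  qed
  have sc: "norm ((1 / \<delta> k) *\<^sub>R z) \<le> m" if "norm z \<le> m * \<delta> k" for k m and z :: "real ^ 'n"
    using that \<delta>[of k] by (simp add: pos_divide_le_eq)
  define x where "x \<sigma> = flow f \<sigma> t1 v" for \<sigma>
  define y where "y k \<sigma> = flow f \<sigma> t1 (w k)" for k \<sigma>
  define u where "u k \<sigma> = (1 / \<delta> k) *\<^sub>R (y k \<sigma> - x \<sigma>)" for k \<sigma>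
  define g where "g k \<sigma> = (1 / \<delta> k) *\<^sub>R (f \<sigma> (y k \<sigma>) - f \<sigma> (x \<sigma>))" for k \<sigma>
  define A where "A \<sigma> = jacobian (f \<sigma>) (at (x \<sigma>))" for \<sigma>
  have yx: "norm (y k \<sigma> - x \<sigma>) \<le> E * D * \<delta> k" if "\<sigma> \<in> {t1..b}" for k \<sigma>
  proof -
    have "norm (y k \<sigma> - x \<sigma>) \<le> E * norm (w k - v)"
      using dep[OF w(2) _ that, of v k] d by (simp add: y_def x_def E_def)
    also have "\<dots> \<le> E * (D * \<delta> k)" using D(2)[of "w k - v"] by (intro mult_left_mono) (auto simp: \<delta>_def E_def)
    finally show ?thesis by (simp add: mult.assoc)
  qed
  have A: "(f \<sigma> has_derivative (\<lambda>z. A \<sigma> *v z)) (at (x \<sigma>))" if "\<sigma> \<in> {a..b}" for \<sigma>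
    using diff[OF that] unfolding A_def x_def jacobian_works .
  have A_bd: "norm (A \<sigma> *v z) \<le> L * norm z" if \<sigma>: "\<sigma> \<in> {a..b}" for \<sigma> z
  proof -
    obtain r where "r > 0" "L-lipschitz_on (cball (x \<sigma>) r) (f \<sigma>)"
      using lip[of \<sigma>] \<sigma> t by (auto simp: x_def)
    then show ?thesis using lipschitz_derivative_bound[OF A[OF \<sigma>]] by blast
  qed
  \<comment> \<open>The norm bound derived from \<open>A_bd\<close> is the same at all times of the
    interval, so one step length serves them all.\<close>
  obtain h0 where h0: "h0 > 0" "\<And>A h u. norm A \<le> real CARD('n) * (real CARD('n) * L) \<Longrightarrow>
      matrix_measure M A \<le> c \<Longrightarrow> 0 < h \<Longrightarrow> h \<le> h0 \<Longrightarrow>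
      M (u + h *\<^sub>R (A *v u)) \<le> (1 + h * c') * M u"
    using uniform_step[OF c(1)] by metis
  have int: "(g k has_integral (u k q - u k p)) {p..q}" if "a \<le> p" "p \<le> q" "q \<le> b" for k p q
  proof -
    have "((\<lambda>\<sigma>. (1 / \<delta> k) *\<^sub>R (f \<sigma> (y k \<sigma>) - f \<sigma> (x \<sigma>))) has_integral
        (1 / \<delta> k) *\<^sub>R ((y k q - y k p) - (x q - x p))) {p..q}"
      unfolding x_def y_def using that t
      by (intro has_integral_cmul has_integral_diff is_solution_has_integral[OF flow_is_solution]) auto
    then show ?thesis unfolding g_def[abs_def] u_def by (simp add: algebra_simps)
  qed
  have gbd: "norm (g k \<sigma>) \<le> L * (E * D)" if "\<sigma> \<in> {a..b}" for k \<sigma>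
  proof -
    have \<sigma>: "\<sigma> \<in> {t1..b}" using that t by auto
    have "norm (f \<sigma> (y k \<sigma>) - f \<sigma> (x \<sigma>)) \<le> L * norm (y k \<sigma> - x \<sigma>)"
      using dep[OF w(2) _ \<sigma>, of v k] d by (simp add: y_def x_def)
    also have "\<dots> \<le> L * (E * D * \<delta> k)" using yx[OF \<sigma>] L by (intro mult_left_mono)
    finally show ?thesis unfolding g_def by (intro sc) (simp add: mult.assoc)
  qed
  have app: "(\<lambda>k. g k \<sigma> - A \<sigma> *v u k \<sigma>) \<longlonglongrightarrow> 0" if \<sigma>: "\<sigma> \<in> {a..b}" for \<sigma>
  proof (rule LIMSEQ_I)
    fix r :: real assume r: "r > 0"
    have \<sigma>': "\<sigma> \<in> {t1..b}" using \<sigma> t by auto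
    have ED: "E * D > 0" using D by (simp add: E_def)
    \<comment> \<open>The normalised difference has norm at most \<open>E * D\<close>, so this
      choice leaves a remainder of at most \<open>r / 2\<close>.\<close>
    define \<epsilon> where "\<epsilon> = r / (2 * (E * D))"
    have "\<epsilon> > 0" using r ED by (simp add: \<epsilon>_def)
    then obtain s where s: "s > 0" "\<And>z. norm (z - x \<sigma>) < s \<Longrightarrow>
        norm (f \<sigma> z - f \<sigma> (x \<sigma>) - A \<sigma> *v (z - x \<sigma>)) \<le> \<epsilon> * norm (z - x \<sigma>)"
      using A[OF \<sigma>] unfolding has_derivative_at_alt by blast
    obtain N where N: "E / s < real N" using reals_Archimedean2 by blast
    show "\<exists>N. \<forall>k\<ge>N. norm (g k \<sigma> - A \<sigma> *v u k \<sigma> - 0) < r"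
    proof (intro exI allI impI)
      fix k assume k: "N \<le> k"
      have "norm (y k \<sigma> - x \<sigma>) \<le> E * norm (w k - v)"
        using dep[OF w(2) _ \<sigma>', of v k] d by (simp add: y_def x_def E_def)
      also have "\<dots> \<le> E * (1 / real (Suc k))"
        using w(3)[of k] by (intro mult_left_mono) (auto simp: E_def)
      also have "\<dots> < s"
      proof -
        have "E / s < real (Suc k)" using N k by simp
        then show ?thesis using s(1) by (simp add: field_simps)
      qed
      finally have "norm (f \<sigma> (y k \<sigma>) - f \<sigma> (x \<sigma>) - A \<sigma> *v (y k \<sigma> - x \<sigma>)) \<le> \<epsilon> * norm (y k \<sigma> - x \<sigma>)"
        by (rule s(2))
      also have "\<dots> \<le> \<epsilon> * (E * D * \<delta> k)" using yx[OF \<sigma>'] \<open>\<epsilon> > 0\<close> by (intro mult_left_mono) auto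
      also have "\<dots> = r / 2 * \<delta> k" using D(1) by (simp add: \<epsilon>_def E_def)
      finally have le: "norm (f \<sigma> (y k \<sigma>) - f \<sigma> (x \<sigma>) - A \<sigma> *v (y k \<sigma> - x \<sigma>)) \<le> r / 2 * \<delta> k" .
      have "g k \<sigma> - A \<sigma> *v u k \<sigma> = (1 / \<delta> k) *\<^sub>R (f \<sigma> (y k \<sigma>) - f \<sigma> (x \<sigma>) - A \<sigma> *v (y k \<sigma> - x \<sigma>))"
        unfolding g_def u_def matrix_vector_mult_scaleR by (simp only: scaleR_diff_right)
      then have "norm (g k \<sigma> - A \<sigma> *v u k \<sigma>) \<le> r / 2" using sc[OF le] by simp
      then show "norm (g k \<sigma> - A \<sigma> *v u k \<sigma> - 0) < r" using r by simp
    qed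
  qed
  have stp: "M (z + h *\<^sub>R (A \<sigma> *v z)) \<le> (1 + h * c') * M z"
    if "\<sigma> \<in> {a..b}" "0 < h" "h \<le> h0" for \<sigma> h z
    using h0(2)[OF norm_matrix_le[OF A_bd[OF that(1)]] _ that(2,3)] meas[OF that(1)]
    by (simp add: A_def x_def)
  have "\<forall>\<^sub>F k in sequentially. M (u k b) \<le> exp (c' * (b - a)) * (M (u k a) + \<Lambda>)"
    using growth[OF \<open>a \<le> b\<close> int gbd A_bd app stp h0(1) \<open>0 \<le> c'\<close> L \<open>\<Lambda> > 0\<close>] .
  then obtain k where k: "M (u k b) \<le> exp (c' * (b - a)) * (M (u k a) + \<Lambda>)"
    using eventually_happens sequentially_bot by blast
  have Mu: "M (u k \<sigma>) * \<delta> k = M (y k \<sigma> - x \<sigma>)" for \<sigma>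
    unfolding u_def scale using \<delta>[of k] by simp
  have "M (u k a) * \<delta> k \<le> \<Lambda> * \<delta> k"
    unfolding Mu using \<Lambda>[OF w(1)[of k]] by (simp add: y_def x_def \<delta>_def)
  then have "M (u k a) \<le> \<Lambda>" using \<delta>[of k] by simp
  then have "M (u k b) \<le> exp (c' * (b - a)) * (2 * \<Lambda>)"
    by (intro order_trans[OF k] mult_left_mono) auto
  moreover have "B * \<delta> k < M (u k b) * \<delta> k"
    unfolding Mu using w(4)[of k] by (simp add: y_def x_def \<delta>_def)
  then have "B < M (u k b)" using \<delta>[of k] by simp
  ultimately show False by (simp add: B_def mult.commute mult.left_commute)
qed

text \<open>The local estimates are chained along the segment of initial states from
  \<open>x\<close> to \<open>y\<close>, at fixed times. Lengths add up there, so the factor 2 does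
  not compound.\<close>

lemma flow_growth:
  assumes t: "t0 \<le> t1" "t1 \<le> a" "a \<le> b" and C: "convex C" "x \<in> C" "y \<in> C"
    and diff: "\<And>t z. t \<in> {a..b} \<Longrightarrow> f t differentiable (at z)"
    and meas: "\<And>t v. t \<in> {a..b} \<Longrightarrow> v \<in> C \<Longrightarrow> matrix_measure M (jacobian (f t) (at (flow f t t1 v))) \<le> c"
    and c: "c < c'" "0 \<le> c'" and "\<Lambda> > 0"
    and \<Lambda>: "\<And>v w. v \<in> C \<Longrightarrow> w \<in> C \<Longrightarrow> M (flow f a t1 w - flow f a t1 v) \<le> \<Lambda> * M (w - v)"
  shows "M (flow f b t1 y - flow f b t1 x) \<le> (2 * \<Lambda> * exp (c' * (b - a))) * M (y - x)"
  using assms by (intro segment_bound[OF C] flow_growth_local[where c = c]) auto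

end

text \<open>Three phases. Up to \<open>t1\<close>, which brings the upper limit below
  \<open>c\<close>, and from there to \<open>t2\<close>, after which the measures stay below
  \<open>c\<close>, the flow is Lipschitz on compact convex sets; from \<open>t2\<close> on
  \<open>flow_growth\<close> applies to the hull of the reachable set. The gap between
  \<open>c\<close> and \<open>c'\<close> is what \<open>uniform_step\<close> consumes.\<close>

lemma (in normed_system) flow_exponential_bound:
  assumes diff: "\<And>t z. t0 \<le> t \<Longrightarrow> f t differentiable (at z)"
    and K: "compact K" and c: "asymptotic_measure M f t0 K < ereal c" "0 \<le> c" "c < c'"
  obtains \<Lambda> where "\<Lambda> > 0"
    "\<And>x y t. x \<in> K \<Longrightarrow> y \<in> K \<Longrightarrow> t0 \<le> t \<Longrightarrow>
      norm (flow f t t0 y - flow f t t0 x) \<le> \<Lambda> * exp (c' * (t - t0)) * norm (y - x)"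
proof -
  obtain t1 where t1: "t0 \<le> t1" and ls: "Limsup at_top (\<lambda>t. SUP v\<in>convex hull (reachable_set f t1 t0 K).
      ereal (matrix_measure M (jacobian (f t) (at (flow f t t1 v))))) < ereal c"
    using c(1) by (auto simp: asymptotic_measure_def INF_less_iff)
  define C where "C = convex hull (reachable_set f t1 t0 K)"
  obtain s where s: "\<And>t. s \<le> t \<Longrightarrow>
      (SUP v\<in>C. ereal (matrix_measure M (jacobian (f t) (at (flow f t t1 v))))) < ereal c"
    using Limsup_lessD[OF ls] by (auto simp: eventually_at_top_linorder C_def)
  define t2 where "t2 = max t1 s"
  have t2: "t1 \<le> t2" "s \<le> t2" by (auto simp: t2_def)
  have meas: "matrix_measure M (jacobian (f t) (at (flow f t t1 v))) \<le> c" if "t2 \<le> t" "v \<in> C" for t v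
  proof -
    have "ereal (matrix_measure M (jacobian (f t) (at (flow f t t1 v))))
        \<le> (SUP v\<in>C. ereal (matrix_measure M (jacobian (f t) (at (flow f t t1 v)))))"
      using that by (intro SUP_upper)
    also have "\<dots> < ereal c" using s that t2 by simp
    finally show ?thesis by simp
  qed
  obtain \<Lambda>0 where \<Lambda>0: "\<Lambda>0 > 0" "\<And>x y t. x \<in> K \<Longrightarrow> y \<in> K \<Longrightarrow> t \<in> {t0..t1} \<Longrightarrow>
      norm (flow f t t0 y - flow f t t0 x) \<le> \<Lambda>0 * norm (y - x)"
  \<comment> \<open>\<open>K\<close> may fail to be convex, so the estimate is obtained on its
    convex hull and then restricted.\<close>
  proof (rule flow_lipschitz_compact[OF order_refl t1 compact_convex_hull[OF K] convex_convex_hull])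
    fix \<Lambda> assume "\<Lambda> > 0" "\<And>x y t. x \<in> convex hull K \<Longrightarrow> y \<in> convex hull K \<Longrightarrow> t \<in> {t0..t1} \<Longrightarrow>
      norm (flow f t t0 y - flow f t t0 x) \<le> \<Lambda> * norm (y - x)"
    then show thesis by (intro that[of \<Lambda>]) (auto intro: hull_inc)
  qed
  have "\<Lambda>0-lipschitz_on K (flow f t1 t0)"
    using \<Lambda>0 t1 by (intro lipschitz_onI) (auto simp: dist_norm)
  then have "compact (reachable_set f t1 t0 K)"
    unfolding reachable_set_def using K by (intro compact_continuous_image lipschitz_on_continuous_on)
  then have C: "compact C" "convex C" by (auto simp: C_def compact_convex_hull)
  have inC: "flow f t1 t0 x \<in> C" if "x \<in> K" for x
    using that unfolding C_def reachable_set_def by (intro hull_inc) auto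
  obtain \<Lambda>1 where \<Lambda>1: "\<Lambda>1 > 0" "\<And>x y t. x \<in> C \<Longrightarrow> y \<in> C \<Longrightarrow> t \<in> {t1..t2} \<Longrightarrow>
      norm (flow f t t1 y - flow f t t1 x) \<le> \<Lambda>1 * norm (y - x)"
    using flow_lipschitz_compact[OF t1 t2(1) C] by metis
  obtain A where A: "A > 0" "\<And>x. M x \<le> A * norm x" using le_norm by blast
  obtain D where D: "D > 0" "\<And>x. norm x \<le> D * M x" using norm_le by blast
  \<comment> \<open>The Lipschitz constant of the second phase, converted from the Euclidean norm to
    \<open>M\<close>.\<close>
  define \<Lambda>2 where "\<Lambda>2 = A * (\<Lambda>1 * D)"
  have \<Lambda>2: "\<Lambda>2 > 0" using A D \<Lambda>1 by (simp add: \<Lambda>2_def)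
  have start: "M (flow f t2 t1 w - flow f t2 t1 v) \<le> \<Lambda>2 * M (w - v)" if "v \<in> C" "w \<in> C" for v w
  proof -
    have "M (flow f t2 t1 w - flow f t2 t1 v) \<le> A * norm (flow f t2 t1 w - flow f t2 t1 v)" by (rule A)
    also have "\<dots> \<le> A * (\<Lambda>1 * norm (w - v))"
      using \<Lambda>1(2)[OF that] t2 A by (intro mult_left_mono) auto
    also have "\<dots> \<le> A * (\<Lambda>1 * (D * M (w - v)))"
      using D A \<Lambda>1 by (intro mult_left_mono) auto
    finally show ?thesis by (simp add: \<Lambda>2_def mult.assoc)
  qed
  define B where "B = D * (2 * \<Lambda>2 * (A * \<Lambda>0))"
  have B: "B > 0" using A D \<Lambda>0 \<Lambda>2 by (simp add: B_def)
  define \<Lambda> where "\<Lambda> = max \<Lambda>0 (max (\<Lambda>1 * \<Lambda>0) B)"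
  show thesis
  proof
    show "\<Lambda> > 0" using \<Lambda>0 by (simp add: \<Lambda>_def)
    fix x y t assume xy: "x \<in> K" "y \<in> K" and t: "t0 \<le> t"
    let ?x = "flow f t1 t0 x" and ?y = "flow f t1 t0 y"
    have xy1: "norm (?y - ?x) \<le> \<Lambda>0 * norm (y - x)" using \<Lambda>0 xy t1 by simp
    \<comment> \<open>Since \<open>c'\<close> is positive the exponential is at least 1, and the
      constants of the first two phases are absorbed.\<close>
    have le: "\<Lambda>' * norm (y - x) \<le> \<Lambda> * exp (c' * (t - t0)) * norm (y - x)" if "\<Lambda>' \<le> \<Lambda>" for \<Lambda>'
    proof -
      have "\<Lambda> * 1 \<le> \<Lambda> * exp (c' * (t - t0))"
        using t c \<open>\<Lambda> > 0\<close> by (intro mult_left_mono) auto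
      then show ?thesis using that by (intro mult_right_mono) auto
    qed
    consider "t \<le> t1" | "t1 \<le> t" "t \<le> t2" | "t2 \<le> t" by linarith
    then show "norm (flow f t t0 y - flow f t t0 x) \<le> \<Lambda> * exp (c' * (t - t0)) * norm (y - x)"
    proof cases
      case 1
      then have "norm (flow f t t0 y - flow f t t0 x) \<le> \<Lambda>0 * norm (y - x)" using \<Lambda>0 xy t by simp
      also have "\<dots> \<le> \<Lambda> * exp (c' * (t - t0)) * norm (y - x)" by (rule le) (simp add: \<Lambda>_def)
      finally show ?thesis .
    next
      case 2
      then have "norm (flow f t t1 ?y - flow f t t1 ?x) \<le> \<Lambda>1 * norm (?y - ?x)"
        using \<Lambda>1 inC xy by simp
      also have "\<dots> \<le> \<Lambda>1 * (\<Lambda>0 * norm (y - x))" using xy1 \<Lambda>1 by (intro mult_left_mono) auto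
      also have "\<dots> = (\<Lambda>1 * \<Lambda>0) * norm (y - x)" by simp
      also have "\<dots> \<le> \<Lambda> * exp (c' * (t - t0)) * norm (y - x)" by (rule le) (simp add: \<Lambda>_def)
      finally show ?thesis using flow_flow[OF order_refl t1 2(1)] by simp
    next
      case 3
      let ?e = "exp (c' * (t - t2))"
      have "M (flow f t t1 ?y - flow f t t1 ?x) \<le> (2 * \<Lambda>2 * ?e) * M (?y - ?x)"
        using t1 t2 3 C inC xy diff meas c \<Lambda>2 start
        by (intro flow_growth[where C = C and c = c]) auto
      also have "\<dots> \<le> (2 * \<Lambda>2 * ?e) * (A * (\<Lambda>0 * norm (y - x)))"
        using A xy1 \<Lambda>2 order_trans[OF A(2) mult_left_mono[OF xy1]] by (intro mult_left_mono) auto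
      finally have "norm (flow f t t1 ?y - flow f t t1 ?x) \<le> D * ((2 * \<Lambda>2 * ?e) * (A * (\<Lambda>0 * norm (y - x))))"
        using D order_trans[OF D(2) mult_left_mono] by (meson less_imp_le)
      also have "\<dots> = B * ?e * norm (y - x)" by (simp add: B_def)
      also have "\<dots> \<le> \<Lambda> * exp (c' * (t - t0)) * norm (y - x)"
        using B c t1 t2 by (intro mult_right_mono mult_mono) (auto simp: \<Lambda>_def)
      finally show ?thesis using flow_flow[OF order_refl t1, of t] 3 t2 by simp
    qed
  qed
qed

section \<open>Spanning sets and entropy\<close>

text \<open>Space is cut into cells of side \<open>s\<close>, labelled by integer vectors, and one
  point of \<open>K\<close> is picked in each cell that meets \<open>K\<close>. Two points of a cell
  differ by at most \<open>s\<close> in each coordinate, and the Euclidean norm is at most the sum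
  of these differences.\<close>

lemma grid_cover:
  fixes K :: "(real ^ 'n) set"
  assumes K: "\<And>x. x \<in> K \<Longrightarrow> norm x \<le> R" and "0 < s" "0 \<le> R"
  obtains E where "E \<subseteq> K" "finite E" "real (card E) \<le> (2 * R / s + 3) ^ CARD('n)"
    "\<And>x. x \<in> K \<Longrightarrow> \<exists>e\<in>E. norm (x - e) \<le> real CARD('n) * s"
proof -
  define q :: "real ^ 'n \<Rightarrow> 'n \<Rightarrow> int" where "q x i = \<lfloor>x $ i / s\<rfloor>" for x i
  define m where "m = \<lceil>R / s\<rceil>"
  define P :: "('n \<Rightarrow> int) set" where "P = UNIV \<rightarrow>\<^sub>E {- m..m}"
  have "q x i \<in> {- m..m}" if "x \<in> K" for x i
  proof -
    have "\<bar>x $ i\<bar> \<le> R" using K[OF that] component_le_norm_cart[of x i] by linarith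
    then have "- (R / s) \<le> x $ i / s" "x $ i / s \<le> R / s"
      using \<open>0 < s\<close> by (auto simp: field_simps)
    then show ?thesis unfolding q_def m_def by (auto simp: le_floor_iff ceiling_def) linarith+
  qed
  then have sub: "q ` K \<subseteq> P" by (auto simp: P_def)
  have fin: "finite P" unfolding P_def by (intro finite_PiE) auto
  have "0 \<le> R / s" using \<open>0 \<le> R\<close> \<open>0 < s\<close> by simp
  then have "m \<ge> 0" unfolding m_def by linarith
  then have "real (card {- m..m}) = 2 * of_int m + 1" by simp
  also have "\<dots> \<le> 2 * R / s + 3" unfolding m_def by linarith
  finally have "real (card {- m..m}) \<le> 2 * R / s + 3" .
  then have cardP: "real (card P) \<le> (2 * R / s + 3) ^ CARD('n)"
    by (simp add: P_def card_PiE power_mono)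
  \<comment> \<open>Cell centres could lie outside \<open>K\<close>; choosing preimages keeps
    \<open>E\<close> inside \<open>K\<close>, as spanning sets require.\<close>
  define E where "E = inv_into K q ` (q ` K)"
  show thesis
  proof
    show "E \<subseteq> K" unfolding E_def by (auto intro: inv_into_into)
    have finq: "finite (q ` K)" using sub fin finite_subset by blast
    then show "finite E" by (simp add: E_def)
    have "card E \<le> card (q ` K)" unfolding E_def by (rule card_image_le[OF finq])
    also have "\<dots> \<le> card P" by (rule card_mono[OF fin sub])
    finally show "real (card E) \<le> (2 * R / s + 3) ^ CARD('n)" using cardP by simp
    fix x assume x: "x \<in> K"
    define e where "e = inv_into K q (q x)"
    have "q e = q x" unfolding e_def using x by (intro f_inv_into_f) auto
    then have fl: "\<lfloor>x $ i / s\<rfloor> = \<lfloor>e $ i / s\<rfloor>" for i by (auto simp: q_def dest: fun_cong[of _ _ i])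
    have "\<bar>x $ i / s - e $ i / s\<bar> \<le> 1" for i
      using fl[of i] floor_correct[of "x $ i / s"] floor_correct[of "e $ i / s"] by linarith
    then have "\<bar>(x - e) $ i\<bar> \<le> s" for i using \<open>0 < s\<close> by (simp add: diff_divide_distrib[symmetric])
    then have "(\<Sum>i\<in>UNIV. \<bar>(x - e) $ i\<bar>) \<le> of_nat CARD('n) * s" by (intro sum_bounded_above)
    then have "norm (x - e) \<le> real CARD('n) * s" using norm_le_l1_cart[of "x - e"] by linarith
    moreover have "e \<in> E" using x by (auto simp: E_def e_def)
    ultimately show "\<exists>e\<in>E. norm (x - e) \<le> real CARD('n) * s" by blast
  qed
qed

lemma log_enat_mono: "k \<le> l \<Longrightarrow> log_enat k \<le> log_enat l"
proof (cases k; cases l)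
  fix m n assume "k \<le> l" "k = enat m" "l = enat n"
  \<comment> \<open>Since \<open>ln 0\<close> is 0, monotonicity at \<open>m = 0\<close> needs the
    logarithms of all natural numbers to be nonnegative.\<close>
  moreover from this have "m = 0 \<Longrightarrow> 0 \<le> ln (real n)" by (cases n) auto
  ultimately show ?thesis by (cases "m = 0") (auto simp: log_enat_def)
qed (auto simp: log_enat_def)

lemma spanning_number_antimono:
  assumes "\<epsilon> \<le> \<epsilon>'"
  shows "spanning_number N f t0 \<epsilon>' T K \<le> spanning_number N f t0 \<epsilon> T K"
proof -
  have "bowen_ball N f t0 x \<epsilon> T \<subseteq> bowen_ball N f t0 x \<epsilon>' T" for x
    using assms by (auto simp: bowen_ball_def intro: less_le_trans)
  then have "is_spanning N f t0 \<epsilon>' T K E" if "is_spanning N f t0 \<epsilon> T K E" for E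
    using that unfolding is_spanning_def by blast
  then show ?thesis
    unfolding spanning_number_def by (intro INF_superset_mono) auto
qed

text \<open>\<open>Lim\<close> is informative only once convergence is known. The inner upper limit
  grows as \<epsilon> decreases, so it converges from the right to its supremum over positive
  \<epsilon>.\<close>

lemma topological_entropy_le:
  assumes "\<And>\<epsilon>. \<epsilon> > 0 \<Longrightarrow>
    Limsup at_top (\<lambda>T. log_enat (spanning_number N f t0 \<epsilon> T K) / ereal T) \<le> B"
  shows "topological_entropy N f t0 K \<le> B"
proof -
  define H where "H \<epsilon> = Limsup at_top (\<lambda>T. log_enat (spanning_number N f t0 \<epsilon> T K) / ereal T)" for \<epsilon> :: real
  have anti: "H \<epsilon>' \<le> H \<epsilon>" if "\<epsilon> \<le> \<epsilon>'" for \<epsilon> \<epsilon>'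
    unfolding H_def
  proof (rule Limsup_mono)
    show "\<forall>\<^sub>F T in at_top. log_enat (spanning_number N f t0 \<epsilon>' T K) / ereal T
        \<le> log_enat (spanning_number N f t0 \<epsilon> T K) / ereal T"
      using eventually_gt_at_top[of 0]
      by eventually_elim
        (intro ereal_divide_right_mono log_enat_mono spanning_number_antimono that, simp)
  qed
  have "(H \<longlongrightarrow> (SUP \<epsilon>\<in>{0<..}. H \<epsilon>)) (at_right 0)"
  proof (rule order_tendstoI)
    fix a assume "a < (SUP \<epsilon>\<in>{0<..}. H \<epsilon>)"
    then obtain \<epsilon> where "\<epsilon> > 0" "a < H \<epsilon>" by (auto simp: less_SUP_iff)
    then show "\<forall>\<^sub>F \<epsilon> in at_right 0. a < H \<epsilon>"
      using anti by (auto simp: eventually_at_right_field intro!: exI[of _ \<epsilon>] intro: less_le_trans less_imp_le)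
  next
    fix a assume "(SUP \<epsilon>\<in>{0<..}. H \<epsilon>) < a"
    then have "H \<epsilon> < a" if "\<epsilon> > 0" for \<epsilon>
      using that SUP_upper[of \<epsilon> "{0<..}" H] by auto
    then show "\<forall>\<^sub>F \<epsilon> in at_right 0. H \<epsilon> < a"
      by (auto simp: eventually_at_right_field intro: exI[of _ 1])
  qed
  then have "topological_entropy N f t0 K = (SUP \<epsilon>\<in>{0<..}. H \<epsilon>)"
    unfolding topological_entropy_def H_def[abs_def, symmetric]
    by (intro tendsto_Lim) auto
  also have "\<dots> \<le> B" using assms by (intro SUP_least) (simp add: H_def)
  finally show ?thesis .
qed

text \<open>The exponential bound makes a grid of mesh \<open>s\<close>, proportional to
  \<open>\<epsilon> * exp (- c * T)\<close>, spanning up to time \<open>T\<close>. Its cardinality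
  is at most the power \<open>CARD('n)\<close> of \<open>P * exp (c * T)\<close>, and
  \<open>P\<close> disappears after dividing the logarithm by \<open>T\<close>.\<close>

lemma (in vector_norm) Limsup_spanning_number_le:
  assumes K: "bounded K" and "\<Lambda> > 0" "0 \<le> c" "\<epsilon> > 0"
    and lip: "\<And>x y t. x \<in> K \<Longrightarrow> y \<in> K \<Longrightarrow> t0 \<le> t \<Longrightarrow>
      norm (flow f t t0 y - flow f t t0 x) \<le> \<Lambda> * exp (c * (t - t0)) * norm (y - x)"
  shows "Limsup at_top (\<lambda>T. log_enat (spanning_number M f t0 \<epsilon> T K) / ereal T)
    \<le> ereal (real CARD('n) * c)"
proof -
  let ?n = "real CARD('n)"
  obtain A where A: "A > 0" "\<And>x. M x \<le> A * norm x" using le_norm by blast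
  obtain R where R: "R > 0" "\<And>x. x \<in> K \<Longrightarrow> norm x \<le> R" using K bounded_pos by blast
  define Q where "Q = A * \<Lambda> * ?n"
  have Q: "Q > 0" using A \<open>\<Lambda> > 0\<close> by (simp add: Q_def)
  \<comment> \<open>For the mesh \<open>s\<close> below, \<open>2 * R / s\<close> equals
    \<open>(P - 3) * exp (c * T)\<close>; the remaining 3 is absorbed because the exponential is at
    least 1.\<close>
  define P where "P = 4 * R * Q / \<epsilon> + 3"
  have P: "P \<ge> 3" using R Q \<open>\<epsilon> > 0\<close> by (simp add: P_def)
  have bound: "log_enat (spanning_number M f t0 \<epsilon> T K) \<le> ereal (?n * (ln P + c * T))" if T: "T > 0" for T
  proof -
    \<comment> \<open>Grid neighbours then stay within \<open>\<epsilon> / 2\<close> in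
      \<open>M\<close>. The half keeps the supremum in \<open>bowen_ball\<close> strictly below
      \<epsilon>.\<close>
    define s where "s = \<epsilon> / (2 * (Q * exp (c * T)))"
    have s: "s > 0" using Q \<open>\<epsilon> > 0\<close> by (simp add: s_def)
    obtain E where E: "E \<subseteq> K" "finite E" "real (card E) \<le> (2 * R / s + 3) ^ CARD('n)"
      "\<And>x. x \<in> K \<Longrightarrow> \<exists>e\<in>E. norm (x - e) \<le> ?n * s"
      using grid_cover[OF R(2) s] R(1) by (metis less_imp_le)
    have ball: "x \<in> bowen_ball M f t0 e \<epsilon> T" if "x \<in> K" "e \<in> K" "norm (x - e) \<le> ?n * s" for x e
    proof -
      have "M (flow f t t0 x - flow f t t0 e) \<le> \<epsilon> / 2" if t: "t \<in> {t0..t0 + T}" for t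
      proof -
        have "M (flow f t t0 x - flow f t t0 e) \<le> A * norm (flow f t t0 x - flow f t t0 e)" by (rule A)
        also have "\<dots> \<le> A * (\<Lambda> * exp (c * (t - t0)) * norm (x - e))"
          using lip[OF \<open>e \<in> K\<close> \<open>x \<in> K\<close>] t A by (intro mult_left_mono) auto
        also have "\<dots> \<le> A * (\<Lambda> * exp (c * T) * (?n * s))"
          using \<open>norm (x - e) \<le> ?n * s\<close> t A \<open>\<Lambda> > 0\<close> \<open>0 \<le> c\<close>
          by (intro mult_left_mono mult_mono) (auto intro: mult_left_mono)
        also have "\<dots> = Q * exp (c * T) * s" by (simp add: Q_def)
        also have "\<dots> = \<epsilon> / 2" using Q by (simp add: s_def)
        finally show ?thesis .
      qed
      then have "(SUP t\<in>{t0..t0 + T}. ereal (M (flow f t t0 x - flow f t t0 e))) \<le> ereal (\<epsilon> / 2)"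
        by (intro SUP_least) simp
      also have "\<dots> < ereal \<epsilon>" using \<open>\<epsilon> > 0\<close> by simp
      finally show ?thesis by (simp add: bowen_ball_def)
    qed
    have "is_spanning M f t0 \<epsilon> T K E"
      unfolding is_spanning_def
    proof (intro conjI subsetI)
      fix x assume "x \<in> K"
      moreover from E(4)[OF this] obtain e where "e \<in> E" "norm (x - e) \<le> ?n * s" ..
      ultimately show "x \<in> (\<Union>e\<in>E. bowen_ball M f t0 e \<epsilon> T)" using ball E(1) by auto
    qed (use E(1) in auto)
    then have "spanning_number M f t0 \<epsilon> T K \<le> enat (card E)"
      unfolding spanning_number_def using E(2) by (intro INF_lower) simp
    then have "log_enat (spanning_number M f t0 \<epsilon> T K) \<le> ereal (ln (real (card E)))"
      using log_enat_mono[of _ "enat (card E)"] by (simp add: log_enat_def[of "enat _"])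
    also have "\<dots> \<le> ereal (?n * (ln P + c * T))"
    \<comment> \<open>For empty \<open>K\<close> the set \<open>E\<close> may be empty; the
      logarithm is then 0 by convention and the right-hand side is nonnegative.\<close>
    proof (cases "card E = 0")
      case True
      then show ?thesis using P T \<open>0 \<le> c\<close> by simp
    next
      case False
      have e1: "1 \<le> exp (c * T)" using T \<open>0 \<le> c\<close> by simp
      have "2 * R / s + 3 = (P - 3) * exp (c * T) + 3"
        using Q \<open>\<epsilon> > 0\<close> by (simp add: s_def P_def field_simps)
      also have "\<dots> \<le> P * exp (c * T)" using e1 by (simp add: algebra_simps)
      finally have "(2 * R / s + 3) ^ CARD('n) \<le> (P * exp (c * T)) ^ CARD('n)"
        using R s by (intro power_mono) auto
      then have "real (card E) \<le> (P * exp (c * T)) ^ CARD('n)" using E(3) by linarith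
      then have "ln (real (card E)) \<le> ln ((P * exp (c * T)) ^ CARD('n))"
        using False by (subst ln_le_cancel_iff) (use P in auto)
      also have "\<dots> = ?n * (ln P + c * T)" using P by (simp add: ln_realpow ln_mult)
      finally show ?thesis by simp
    qed
    finally show ?thesis .
  qed
  have "Limsup at_top (\<lambda>T. log_enat (spanning_number M f t0 \<epsilon> T K) / ereal T)
      \<le> Limsup at_top (\<lambda>T. ereal (?n * ln P / T + ?n * c))"
  proof (rule Limsup_mono)
    show "\<forall>\<^sub>F T in at_top. log_enat (spanning_number M f t0 \<epsilon> T K) / ereal T
        \<le> ereal (?n * ln P / T + ?n * c)"
      using eventually_gt_at_top[of 0]
    proof eventually_elim
      case (elim T)
      have "log_enat (spanning_number M f t0 \<epsilon> T K) / ereal T \<le> ereal (?n * (ln P + c * T)) / ereal T"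
        using elim by (intro ereal_divide_right_mono bound) auto
      also have "\<dots> = ereal (?n * ln P / T + ?n * c)" using elim by (simp add: field_simps)
      finally show ?case .
    qed
  qed
  also have "\<dots> = ereal (?n * c)"
  proof (rule lim_imp_Limsup)
    have "((\<lambda>T. ?n * ln P / T + ?n * c) \<longlongrightarrow> 0 + ?n * c) at_top"
      by (intro tendsto_add tendsto_const real_tendsto_divide_at_top[OF tendsto_const filterlim_ident])
    then show "((\<lambda>T. ereal (?n * ln P / T + ?n * c)) \<longlongrightarrow> ereal (?n * c)) at_top" by simp
  qed simp
  finally show ?thesis .
qed

theorem proposition2:
  fixes f :: "real \<Rightarrow> real ^ 'n \<Rightarrow> real ^ 'n"
    and t0 :: real
    and K :: "(real ^ 'n) set"
    and N M :: "real ^ 'n \<Rightarrow> real"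
  assumes "\<And>x. piecewise_continuous_from t0 (\<lambda>t. f t x)"
    and "\<And>t. t \<ge> t0 \<Longrightarrow> C1_map (f t)"
    and "local_lipschitz {t0..} UNIV f"
    and "forward_complete f t0"
    and "compact K"
    and "interior K \<noteq> {}"
    and "is_norm N"
    and "is_norm M"
  shows "topological_entropy N f t0 K
           \<le> ereal (real CARD('n)) * max (asymptotic_measure M f t0 K) 0"
proof -
  interpret N: vector_norm N by unfold_locales fact
  interpret normed_system M f t0 by unfold_locales fact+
  let ?m = "max (asymptotic_measure M f t0 K) 0"
  have diff: "f t differentiable (at z)" if "t0 \<le> t" for t z
    using assms(2)[OF that] by (simp add: C1_map_def)
  have le: "topological_entropy N f t0 K \<le> ereal (real CARD('n) * c')" if c': "?m < ereal c'" for c'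
  proof -
    \<comment> \<open>The exponential bound needs a rate strictly between the maximum and
      \<open>c'\<close>. Its conclusion is Euclidean, so it passes from \<open>M\<close>, which
      governs the growth, to \<open>N\<close>, which measures the Bowen balls.\<close>
    obtain c where c: "?m < ereal c" "ereal c < ereal c'"
      using ereal_dense2[OF c'] by auto
    then have "0 \<le> c" "c < c'" "asymptotic_measure M f t0 K < ereal c" by auto
    then obtain \<Lambda> where \<Lambda>: "\<Lambda> > 0" "\<And>x y t. x \<in> K \<Longrightarrow> y \<in> K \<Longrightarrow> t0 \<le> t \<Longrightarrow>
      norm (flow f t t0 y - flow f t t0 x) \<le> \<Lambda> * exp (c' * (t - t0)) * norm (y - x)"
      using flow_exponential_bound[OF diff assms(5), of c c'] by metis
    show ?thesis
      using \<open>0 \<le> c\<close> \<open>c < c'\<close> \<Lambda> compact_imp_bounded[OF assms(5)]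
      by (intro topological_entropy_le N.Limsup_spanning_number_le) auto
  qed
  show ?thesis
  proof (cases ?m)
    case (real m)
    show ?thesis unfolding real
    proof (rule ereal_le_epsilon2)
      fix e :: real assume "e > 0"
      \<comment> \<open>The division compensates for the factor \<open>CARD('n)\<close> in the
        bound.\<close>
      then have "?m < ereal (m + e / real CARD('n))" unfolding real by simp
      from le[OF this] show "topological_entropy N f t0 K \<le> ereal (real CARD('n)) * ereal m + ereal e"
        by (simp add: distrib_left)
    qed
  next
    case PInf
    then show ?thesis by simp
  next
    case MInf
    then have "0 \<le> (-\<infinity> :: ereal)" by (metis max.cobounded2)
    then show ?thesis by simp
  qed
qed

end
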